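(* Let $p$ be a prime and let $X\subseteq\mathbb{Z}/p\mathbb{Z}$ with $0\in X$, $|X|\ge 4$ and $\kappa_5(X)\le |X|+1$. Suppose $p>|X|+42$. Then (i) every $4$-atom of $X$ has cardinality $4$; (ii) if $|X|=4$, then every $5$-atom of $X$ has cardinality $5$.
   Context: For $X\subseteq\mathbb{Z}/p\mathbb{Z}$ and a positive integer $k$, the $k$-th isoperimetric number of $X$ is $$\kappa_k(X)=\min\{|S+X|-|S| : S\subseteq\mathbb{Z}/p\mathbb{Z},\ |S|\ge k,\ |S+X|\le p-k\},$$ with the convention $\min\emptyset=p$. A set $S$ attaining this minimum (with $|S|\ge k$ and $|S+X|\le p-k$) is a $k$-fragment of $X$; a $k$-fragment of minimal cardinality is a $k$-atom of $X$. *)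

theory Defs
  imports "HOL-Number_Theory.Residues"
begin

text \<open>
  \<open>\<int>/p\<int>\<close> is \<open>residue_ring p\<close>, with carrier \<open>{0..p - 1}\<close>; the sumset \<open>S + X\<close> is the library's
  \<open>set_add\<close> in this ring. Cardinalities are compared in \<open>int\<close>, so that neither \<open>p - k\<close> nor
  \<open>|S + X| - |S|\<close> (negative when \<open>X\<close> is empty) is truncated.
\<close>

definition admissible :: "nat \<Rightarrow> nat \<Rightarrow> int set \<Rightarrow> int set \<Rightarrow> bool" where
  "admissible p k X S \<longleftrightarrow>
     S \<subseteq> carrier (residue_ring (int p)) \<and> card S \<ge> k \<and>
     int (card (S <+>\<^bsub>residue_ring (int p)\<^esub> X)) \<le> int p - int k"

definition growth :: "nat \<Rightarrow> int set \<Rightarrow> int set \<Rightarrow> int" where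
  "growth p X S = int (card (S <+>\<^bsub>residue_ring (int p)\<^esub> X)) - int (card S)"

definition isoperimetric_number :: "nat \<Rightarrow> nat \<Rightarrow> int set \<Rightarrow> int" where
  "isoperimetric_number p k X =
     (if \<exists>S. admissible p k X S then Min {growth p X S |S. admissible p k X S} else int p)"

definition is_fragment :: "nat \<Rightarrow> nat \<Rightarrow> int set \<Rightarrow> int set \<Rightarrow> bool" where
  "is_fragment p k X S \<longleftrightarrow> admissible p k X S \<and> growth p X S = isoperimetric_number p k X"

definition is_atom :: "nat \<Rightarrow> nat \<Rightarrow> int set \<Rightarrow> int set \<Rightarrow> bool" where
  "is_atom p k X A \<longleftrightarrow> is_arg_min card (is_fragment p k X) A"

end

theory Submission imports Defs begin

text \<open>
  Suppose that a \<open>4\<close>-atom \<open>A\<close> of \<open>X\<close> has more than four elements. Its translates meet it in at most three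
  elements, and counting representations in \<open>A + N\<close>, for a \<open>2\<close>-atom \<open>N\<close> of \<open>A\<close>, gives \<open>|A| \<le> 6\<close> and a
  difference \<open>d\<close> for which \<open>A\<close> has at most three \<open>d\<close>-runs. By submodularity the isoperimetric numbers
  \<open>\<kappa>\<^sub>3(X)\<close> and \<open>\<kappa>\<^sub>4(X)\<close> agree, and so do \<open>\<kappa>\<^sub>2(X)\<close> and \<open>\<kappa>\<^sub>4(X)\<close> where this is needed. Hence the sets
  \<open>F = A + {0, d, \<dots>, t d}\<close> are fragments until \<open>F + X\<close> is nearly everything. At that point \<open>Y = - (F + X)\<close> and
  \<open>- F\<close> (complements) have the same number \<open>q \<le> 3\<close> of runs, separated by long gaps, and \<open>Y - X \<subseteq> - F\<close>;
  adding up the positions of the runs forces \<open>q X\<close> into a progression of \<open>\<kappa>\<^sub>4(X) + 1\<close> terms with difference \<open>d\<close>.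
  So \<open>X\<close> lies in a progression of that length, and a progression of four terms with the same
  difference is a \<open>4\<close>-fragment of \<open>X\<close>, a contradiction. The second claim is proved in the same way.
\<close>

section \<open>Periodic sets of integers\<close>

text \<open>Subsets of \<open>\<int>/p\<close> are represented by \<open>p\<close>-periodic sets of integers, so that runs become intervals.\<close>

locale prime_modulus =
  fixes p :: int
  assumes prime_p: "prime p"
begin

lemma p_gt_1: "p > 1"
  using prime_p prime_gt_1_int by blast

definition periodic :: "int set \<Rightarrow> bool" where
  "periodic S \<longleftrightarrow> (\<forall>z. z + p \<in> S \<longleftrightarrow> z \<in> S)"

definition sz :: "int set \<Rightarrow> int" where
  "sz S = int (card (S \<inter> {0..<p}))"

definition shift :: "int \<Rightarrow> int set \<Rightarrow> int set" where
  "shift g S = {z. z - g \<in> S}"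

definition sumset :: "int set \<Rightarrow> int set \<Rightarrow> int set" (infixl "\<uplus>" 65) where
  "S \<uplus> X = {z. \<exists>x\<in>X. z - x \<in> S}"

lemma mem_shift [simp]: "z \<in> shift g S \<longleftrightarrow> z - g \<in> S"
  by (simp add: shift_def)

lemma mem_sumset: "z \<in> S \<uplus> X \<longleftrightarrow> (\<exists>x\<in>X. z - x \<in> S)"
  by (simp add: sumset_def)

lemma periodic_mult:
  assumes "periodic S"
  shows "z + k * p \<in> S \<longleftrightarrow> z \<in> S"
proof -
  have nat: "z + int n * p \<in> S \<longleftrightarrow> z \<in> S" for n z
  proof (induction n)
    case (Suc n)
    have "z + int (Suc n) * p = (z + int n * p) + p" by (simp add: algebra_simps)
    then show ?case using Suc assms unfolding periodic_def by metis
  qed simp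
  show ?thesis
  proof (cases "k \<ge> 0")
    case True
    then show ?thesis using nat[of z "nat k"] by simp
  next
    case False
    then show ?thesis using nat[of "z + k * p" "nat (-k)"] by (simp add: algebra_simps)
  qed
qed

lemma periodic_cong:
  assumes "periodic S" "[x = y] (mod p)"
  shows "x \<in> S \<longleftrightarrow> y \<in> S"
proof -
  obtain k where "x = y + k * p"
    using assms(2) by (metis cong_iff_lin cong_sym mult.commute)
  then show ?thesis using periodic_mult[OF assms(1)] by simp
qed

lemma periodic_mod: "periodic S \<Longrightarrow> z mod p \<in> S \<longleftrightarrow> z \<in> S"
  by (rule periodic_cong) (simp_all add: cong_def)

lemma periodic_Un [simp]: "periodic S \<Longrightarrow> periodic T \<Longrightarrow> periodic (S \<union> T)"
  and periodic_Int [simp]: "periodic S \<Longrightarrow> periodic T \<Longrightarrow> periodic (S \<inter> T)"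
  and periodic_Diff [simp]: "periodic S \<Longrightarrow> periodic T \<Longrightarrow> periodic (S - T)"
  and periodic_Compl [simp]: "periodic S \<Longrightarrow> periodic (- S)"
  and periodic_UNIV [simp]: "periodic UNIV"
  and periodic_empty [simp]: "periodic {}"
  by (auto simp: periodic_def)

lemma periodic_shift [simp]: "periodic S \<Longrightarrow> periodic (shift g S)"
  unfolding periodic_def mem_shift by (metis diff_add_eq)

lemma periodic_sumset [simp]: "periodic S \<Longrightarrow> periodic (S \<uplus> X)"
  unfolding periodic_def mem_sumset by (metis diff_add_eq)

lemma sz_nonneg [simp]: "sz S \<ge> 0"
  by (simp add: sz_def)

lemma sz_UNIV [simp]: "sz UNIV = p"
  using p_gt_1 by (simp add: sz_def)

lemma sz_mono: "S \<subseteq> T \<Longrightarrow> sz S \<le> sz T"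
  unfolding sz_def by (simp add: card_mono inf.coboundedI1 Int_mono)

lemma sz_Un_Int: "sz (S \<union> T) + sz (S \<inter> T) = sz S + sz T"
proof -
  have "(S \<union> T) \<inter> {0..<p} = (S \<inter> {0..<p}) \<union> (T \<inter> {0..<p})"
    "(S \<inter> T) \<inter> {0..<p} = (S \<inter> {0..<p}) \<inter> (T \<inter> {0..<p})" by auto
  then show ?thesis
    unfolding sz_def using card_Un_Int[of "S \<inter> {0..<p}" "T \<inter> {0..<p}"] by simp
qed

lemma sz_empty [simp]: "sz {} = 0"
  by (simp add: sz_def)

lemma sz_Compl: "sz (- S) = p - sz S"
  using sz_Un_Int[of S "- S"] by simp

lemma sz_Diff: "sz (S - T) = sz S - sz (S \<inter> T)"
proof -
  have "(S - T) \<union> (S \<inter> T) = S" "(S - T) \<inter> (S \<inter> T) = {}" by auto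
  then show ?thesis using sz_Un_Int[of "S - T" "S \<inter> T"] by simp
qed

lemma sz_pos_iff: "periodic S \<Longrightarrow> 0 < sz S \<longleftrightarrow> S \<noteq> {}"
proof -
  assume S: "periodic S"
  have "S \<inter> {0..<p} \<noteq> {}" if x: "x \<in> S" for x
  proof -
    have "x mod p \<in> S \<inter> {0..<p}" using x periodic_mod[OF S] p_gt_1 by simp
    then show ?thesis by blast
  qed
  then have "S \<inter> {0..<p} \<noteq> {} \<longleftrightarrow> S \<noteq> {}" by blast
  then show ?thesis by (simp add: sz_def card_gt_0_iff)
qed

lemma sz_posI: "periodic S \<Longrightarrow> x \<in> S \<Longrightarrow> 0 < sz S"
  using sz_pos_iff[of S] by blast

lemma sz_subset_eq:
  assumes "periodic S" "periodic T" "S \<subseteq> T" "sz T \<le> sz S"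
  shows "S = T"
proof -
  have "sz (T - S) = sz T - sz S"
    using assms(3) by (simp add: sz_Diff Int_absorb1)
  then have "\<not> 0 < sz (T - S)" using assms(4) by simp
  then show ?thesis using assms sz_pos_iff[of "T - S"] by auto
qed

lemma sz_bij:
  assumes "bij_betw f (S \<inter> {0..<p}) (T \<inter> {0..<p})"
  shows "sz S = sz T"
  using bij_betw_same_card[OF assms] by (simp add: sz_def)

text \<open>As \<open>d\<close> is invertible modulo \<open>p\<close>, the map taking
  \<open>z\<close> to \<open>d z + g\<close> permutes the residues. Translations and the reflection
  are the cases \<open>d = 1\<close> and \<open>d = -1\<close>.\<close>

lemma sz_dilate:
  assumes "periodic S" "coprime d p"
  shows "sz {z. d * z + g \<in> S} = sz S"
proof (rule sz_bij)
  let ?f = "\<lambda>z. (d * z + g) mod p"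
  obtain e where e: "[d * e = 1] (mod p)" using assms(2) cong_solve_coprime_int by blast
  show "bij_betw ?f ({z. d * z + g \<in> S} \<inter> {0..<p}) (S \<inter> {0..<p})"
  proof (rule bij_betwI')
    fix x y assume xy: "x \<in> {z. d * z + g \<in> S} \<inter> {0..<p}" "y \<in> {z. d * z + g \<in> S} \<inter> {0..<p}"
    show "(?f x = ?f y) = (x = y)"
    proof
      assume "?f x = ?f y"
      then have "[d * x = d * y] (mod p)"
        by (metis cong_add_rcancel cong_def)
      then have "[x = y] (mod p)" using assms(2) cong_mult_lcancel by blast
      then show "x = y" using xy by (simp add: cong_def)
    qed simp
  next
    fix x assume "x \<in> {z. d * z + g \<in> S} \<inter> {0..<p}"
    then show "?f x \<in> S \<inter> {0..<p}" using p_gt_1 periodic_mod[OF assms(1)] by simp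
  next
    fix y assume y: "y \<in> S \<inter> {0..<p}"
    define x where "x = (e * (y - g)) mod p"
    have "[d * x + g = d * e * (y - g) + g] (mod p)"
      unfolding x_def by (intro cong_add cong_refl) (simp add: cong_def mod_simps mult.assoc)
    also have "[d * e * (y - g) + g = 1 * (y - g) + g] (mod p)"
      by (intro cong_add cong_mult e cong_refl)
    finally have c: "[d * x + g = y] (mod p)" by simp
    then have "d * x + g \<in> S" using y periodic_cong[OF assms(1) c] by simp
    moreover have "?f x = y" using c y by (simp add: cong_def)
    ultimately show "\<exists>x\<in>{z. d * z + g \<in> S} \<inter> {0..<p}. y = ?f x"
      using p_gt_1 by (intro bexI[of _ x]) (auto simp: x_def)
  qed
qed

lemma sz_shift [simp]: "periodic S \<Longrightarrow> sz (shift g S) = sz S"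
  using sz_dilate[of S 1 "- g"] by (simp add: shift_def)

lemma sz_reflect: "periodic S \<Longrightarrow> sz {z. - z \<in> S} = sz S"
  using sz_dilate[of S "-1" 0] by simp

lemma periodic_reflect: "periodic S \<Longrightarrow> periodic {z. - z \<in> S}"
  using periodic_mult[of S _ "-1"] by (simp add: periodic_def)

lemma coprime_p: "\<not> p dvd g \<Longrightarrow> coprime g p"
  using prime_p by (metis coprime_commute prime_imp_coprime)

text \<open>Stepping back by \<open>g\<close> never leaves \<open>S\<close>, and as \<open>p\<close>
  is prime the multiples of \<open>g\<close> reach every residue.\<close>

lemma shift_subset_imp_UNIV:
  assumes S: "periodic S" "S \<noteq> {}" and g: "\<not> p dvd g" and sub: "S \<subseteq> shift g S"
  shows "S = UNIV"
proof -
  obtain z where z: "z \<in> S" using S(2) by blast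
  have it: "z - int i * g \<in> S" for i
  proof (induction i)
    case (Suc i)
    then show ?case using sub by (auto simp: algebra_simps dest!: subsetD)
  qed (use z in simp)
  obtain e where e: "[g * e = 1] (mod p)" using coprime_p[OF g] cong_solve_coprime_int by blast
  show ?thesis
  proof (intro equalityI subset_UNIV subsetI)
    fix w
    define i where "i = (e * (z - w)) mod p"
    have "[z - i * g = z - g * e * (z - w)] (mod p)"
      unfolding i_def
      by (intro cong_diff cong_refl) (simp add: cong_def mod_simps mult_ac)
    also have "[z - g * e * (z - w) = z - 1 * (z - w)] (mod p)"
      by (intro cong_diff cong_mult e cong_refl)
    finally have "[z - i * g = w] (mod p)" by simp
    then have eq: "z - i * g \<in> S \<longleftrightarrow> w \<in> S" by (rule periodic_cong[OF S(1)])
    have "i \<ge> 0" using p_gt_1 by (simp add: i_def)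
    then have "z - i * g \<in> S" using it[of "nat i"] by simp
    then show "w \<in> S" using eq by simp
  qed
qed

lemma sz_Int_shift_less:
  assumes "periodic S" "0 < sz S" "sz S < p" "\<not> p dvd g"
  shows "sz (S \<inter> shift g S) < sz S"
proof (rule ccontr)
  assume "\<not> ?thesis"
  then have "S \<inter> shift g S = S"
    using assms by (intro sz_subset_eq) auto
  then have "S = UNIV" using assms sz_pos_iff shift_subset_imp_UNIV by blast
  then show False using assms(3) by simp
qed

lemma sz_Un_shift_ge:
  assumes "periodic S" "0 < sz S" "sz S < p" "\<not> p dvd g"
  shows "sz S + 1 \<le> sz (S \<union> shift g S)"
  using sz_Int_shift_less[OF assms] sz_Un_Int[of S "shift g S"] assms(1) by simp

section \<open>Sumsets and submodularity\<close>

lemma sumset_Un: "(S \<union> T) \<uplus> X = (S \<uplus> X) \<union> (T \<uplus> X)"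
  by (auto simp: mem_sumset)

lemma sumset_mono: "S \<subseteq> T \<Longrightarrow> S \<uplus> X \<subseteq> T \<uplus> X"
  by (force simp: mem_sumset)

lemma shift_sumset: "shift g S \<uplus> X = shift g (S \<uplus> X)"
  by (auto simp: mem_sumset diff_diff_eq add.commute)

lemma shift_subset_sumset: "x \<in> X \<Longrightarrow> shift x S \<subseteq> S \<uplus> X"
  by (auto simp: mem_sumset)

lemma sumset_commute: "S \<uplus> X = X \<uplus> S"
proof -
  have "z \<in> X \<uplus> S" if "z \<in> S \<uplus> X" for z S X
    using that unfolding mem_sumset by (metis diff_diff_eq2 add_diff_cancel_left')
  then show ?thesis by blast
qed

lemma sz_sumset_ge: "periodic S \<Longrightarrow> X \<noteq> {} \<Longrightarrow> sz S \<le> sz (S \<uplus> X)"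
  by (metis all_not_in_conv shift_subset_sumset sz_mono sz_shift)

text \<open>The sum with an intersection lies in the intersection of the sums, and the sum with a
  union is the union of the sums; the rest is inclusion and exclusion.\<close>

lemma submodular:
  "sz ((S \<inter> T) \<uplus> X) + sz ((S \<union> T) \<uplus> X) \<le> sz (S \<uplus> X) + sz (T \<uplus> X)"
proof -
  have "sz ((S \<inter> T) \<uplus> X) \<le> sz ((S \<uplus> X) \<inter> (T \<uplus> X))"
    by (rule sz_mono) (auto simp: mem_sumset)
  then show ?thesis using sz_Un_Int[of "S \<uplus> X" "T \<uplus> X"] by (simp add: sumset_Un)
qed

section \<open>Incongruent representatives and counting by translates\<close>

lemma obtain_reps:
  assumes "periodic S" "int m \<le> sz S"
  obtains M where "M \<subseteq> S" "card M = m" "finite M"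
    "\<And>x y. x \<in> M \<Longrightarrow> y \<in> M \<Longrightarrow> x \<noteq> y \<Longrightarrow> \<not> p dvd x - y"
proof -
  have "m \<le> card (S \<inter> {0..<p})" using assms(2) by (simp add: sz_def)
  then obtain M where M: "M \<subseteq> S \<inter> {0..<p}" "card M = m" "finite M"
    by (metis finite_Int finite_atLeastLessThan_int obtain_subset_with_card_n)
  have "\<not> p dvd x - y" if "x \<in> M" "y \<in> M" "x \<noteq> y" for x y
  proof
    assume "p dvd x - y"
    then have "x mod p = y mod p" by (simp add: mod_eq_dvd_iff)
    moreover have "x \<in> {0..<p}" "y \<in> {0..<p}" using that M(1) by blast+
    ultimately show False using that(3) by simp
  qed
  then show thesis using M that by blast
qed

definition residues_of :: "int set \<Rightarrow> int set" where
  "residues_of M = {z. \<exists>m\<in>M. [z = m] (mod p)}"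

lemma periodic_residues_of [simp]: "periodic (residues_of M)"
  by (auto simp: periodic_def residues_of_def cong_def)

lemma residues_of_subset: "periodic S \<Longrightarrow> M \<subseteq> S \<Longrightarrow> residues_of M \<subseteq> S"
  unfolding residues_of_def using periodic_cong by fast

lemma sz_residues_of:
  assumes "finite M" "\<And>x y. x \<in> M \<Longrightarrow> y \<in> M \<Longrightarrow> x \<noteq> y \<Longrightarrow> \<not> p dvd x - y"
  shows "sz (residues_of M) = int (card M)"
proof -
  have "residues_of M \<inter> {0..<p} = (\<lambda>z. z mod p) ` M"
    using p_gt_1 by (force simp: residues_of_def cong_def)
  moreover have "inj_on (\<lambda>z. z mod p) M"
    using assms(2) by (auto simp: inj_on_def mod_eq_dvd_iff)
  ultimately show ?thesis by (simp add: sz_def card_image)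
qed

lemma sz_residues_of_le: "finite M \<Longrightarrow> sz (residues_of M) \<le> int (card M)"
proof -
  assume M: "finite M"
  have "residues_of M \<inter> {0..<p} \<subseteq> (\<lambda>z. z mod p) ` M"
    using p_gt_1 by (force simp: residues_of_def cong_def)
  then show ?thesis using M by (simp add: sz_def) (meson card_image_le card_mono finite_imageI order_trans)
qed

text \<open>The number \<open>r\<close> of representations of an element satisfies \<open>(r - 2) (r - 3) \<ge> 0\<close>;
  summing over \<open>V\<close> bounds \<open>V\<close> in terms of the first two moments of \<open>r\<close>.\<close>

lemma union_of_translates:
  assumes A: "periodic A" and V: "\<And>x. x \<in> M \<Longrightarrow> shift x A \<subseteq> V"
    and M: "finite M" "card M = m"
    and c: "\<And>x y. x \<in> M \<Longrightarrow> y \<in> M \<Longrightarrow> x \<noteq> y \<Longrightarrow> sz (A \<inter> shift (x - y) A) \<le> c"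
  shows "4 * int m * sz A - c * int m * (int m - 1) \<le> 6 * sz V"
proof -
  define r :: "int \<Rightarrow> int" where "r z = (\<Sum>x\<in>M. of_bool (z - x \<in> A))" for z
  let ?V = "V \<inter> {0..<p}"
  have cardV: "int (card (S \<inter> {0..<p})) = (\<Sum>z\<in>?V. of_bool (z \<in> S))" if "S \<subseteq> V" for S
    using that by (simp add: Int_assoc[symmetric] Int_def) (rule arg_cong[where f = card], auto)
  have "(\<Sum>z\<in>?V. r z) = (\<Sum>x\<in>M. \<Sum>z\<in>?V. of_bool (z \<in> shift x A))"
    unfolding r_def by (subst sum.swap) simp
  also have "\<dots> = (\<Sum>x\<in>M. sz (shift x A))"
    using cardV V unfolding sz_def by (intro sum.cong refl) presburger
  finally have r1: "(\<Sum>z\<in>?V. r z) = int m * sz A" using A M by simp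
  \<comment> \<open>The second moment counts ordered pairs of translates: each diagonal pair
    contributes \<open>sz A\<close>, every other pair at most \<open>c\<close>.\<close>
  have "(\<Sum>z\<in>?V. r z ^ 2) = (\<Sum>z\<in>?V. \<Sum>x\<in>M. \<Sum>y\<in>M. of_bool (z \<in> shift x A \<inter> shift y A))"
    unfolding r_def power2_eq_square sum_product by (intro sum.cong refl) auto
  also have "\<dots> = (\<Sum>x\<in>M. \<Sum>z\<in>?V. \<Sum>y\<in>M. of_bool (z \<in> shift x A \<inter> shift y A))"
    by (rule sum.swap)
  also have "\<dots> = (\<Sum>x\<in>M. \<Sum>y\<in>M. \<Sum>z\<in>?V. of_bool (z \<in> shift x A \<inter> shift y A))"
    by (rule sum.cong[OF refl sum.swap])
  also have "\<dots> = (\<Sum>x\<in>M. \<Sum>y\<in>M. sz (shift x A \<inter> shift y A))"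
  proof (intro sum.cong refl)
    fix x y assume "x \<in> M" "y \<in> M"
    then have "shift x A \<inter> shift y A \<subseteq> V" using V by blast
    then show "(\<Sum>z\<in>?V. of_bool (z \<in> shift x A \<inter> shift y A)) = sz (shift x A \<inter> shift y A)"
      using cardV unfolding sz_def by presburger
  qed
  also have "\<dots> \<le> (\<Sum>x\<in>M. sz A + (int m - 1) * c)"
  proof (rule sum_mono)
    fix x assume x: "x \<in> M"
    have "sz (shift x A \<inter> shift y A) \<le> c" if "y \<in> M - {x}" for y
    proof -
      have "shift x A \<inter> shift y A = shift y (A \<inter> shift (x - y) A)" by auto
      then show ?thesis using c[of x y] x that A by simp
    qed
    then have "(\<Sum>y\<in>M - {x}. sz (shift x A \<inter> shift y A)) \<le> int (card (M - {x})) * c"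
      by (rule sum_bounded_above)
    moreover have "int (card (M - {x})) = int m - 1"
      using M x by (metis card_Suc_Diff1 of_nat_Suc add_diff_cancel_left')
    ultimately have "(\<Sum>y\<in>M - {x}. sz (shift x A \<inter> shift y A)) \<le> (int m - 1) * c" by simp
    then show "(\<Sum>y\<in>M. sz (shift x A \<inter> shift y A)) \<le> sz A + (int m - 1) * c"
      using M x A by (simp add: sum.remove)
  qed
  finally have r2: "(\<Sum>z\<in>?V. r z ^ 2) \<le> int m * (sz A + (int m - 1) * c)" using M by simp
  have "0 \<le> (\<Sum>z\<in>?V. (r z - 2) * (r z - 3))"
  proof (rule sum_nonneg)
    fix z show "0 \<le> (r z - 2) * (r z - 3)"
    proof (cases "r z \<le> 2")
      case False
      then show ?thesis by (intro mult_nonneg_nonneg) auto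
    qed (simp add: mult_nonpos_nonpos)
  qed
  also have "\<dots> = (\<Sum>z\<in>?V. r z ^ 2) - 5 * (\<Sum>z\<in>?V. r z) + 6 * sz V"
    by (simp add: algebra_simps power2_eq_square sum.distrib sum_subtractf sum_distrib_left sz_def)
  finally show ?thesis using r1 r2 by (simp add: algebra_simps)
qed

section \<open>Fragments and atoms\<close>

definition feasible :: "int \<Rightarrow> int set \<Rightarrow> int set \<Rightarrow> bool" where
  "feasible k X S \<longleftrightarrow> periodic S \<and> k \<le> sz S \<and> sz (S \<uplus> X) \<le> p - k"

text \<open>When a feasible set exists, this says that the \<open>k\<close>-th isoperimetric number
  is at least \<open>c\<close>, without forming a minimum.\<close>

definition iso_ge :: "int \<Rightarrow> int set \<Rightarrow> int \<Rightarrow> bool" where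
  "iso_ge k X c \<longleftrightarrow> (\<forall>S. feasible k X S \<longrightarrow> sz S + c \<le> sz (S \<uplus> X))"

text \<open>The last argument of \<open>atom\<close> is the \<open>k\<close>-th isoperimetric number of \<open>X\<close>.\<close>

definition atom :: "int \<Rightarrow> int set \<Rightarrow> int set \<Rightarrow> int \<Rightarrow> bool" where
  "atom k X A c \<longleftrightarrow> feasible k X A \<and> sz (A \<uplus> X) = sz A + c \<and> iso_ge k X c \<and>
     (\<forall>S. feasible k X S \<longrightarrow> sz (S \<uplus> X) = sz S + c \<longrightarrow> sz A \<le> sz S)"

lemma feasible_subset:
  assumes "feasible k X S" "periodic T" "T \<subseteq> S" "k \<le> sz T"
  shows "feasible k X T"
proof -
  have "sz (T \<uplus> X) \<le> sz (S \<uplus> X)" using assms(3) by (intro sz_mono sumset_mono)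
  then show ?thesis using assms by (auto simp: feasible_def)
qed

lemma iso_geD: "iso_ge k X c \<Longrightarrow> feasible k X S \<Longrightarrow> sz S + c \<le> sz (S \<uplus> X)"
  by (simp add: iso_ge_def)

lemma iso_ge_large:
  "iso_ge k X c \<Longrightarrow> periodic S \<Longrightarrow> k \<le> sz S \<Longrightarrow> min (sz S + c) (p - k + 1) \<le> sz (S \<uplus> X)"
  using iso_geD[of k X c S] by (cases "sz (S \<uplus> X) \<le> p - k") (auto simp: feasible_def)

lemma ex_atom:
  assumes "feasible k X S" "X \<noteq> {}" "sz (S \<uplus> X) \<le> sz S + b"
  obtains A c where "atom k X A c" "c \<le> b"
proof -
  \<comment> \<open>Least growth is chosen first, then least cardinality. \<open>nat\<close> loses
    nothing, since a nonempty \<open>X\<close> makes growth nonnegative.\<close>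
  define g where "g T = nat (sz (T \<uplus> X) - sz T)" for T
  obtain A where A: "feasible k X A" "\<And>T. feasible k X T \<Longrightarrow> g A \<le> g T"
    using ex_has_least_nat[of "feasible k X" S g] assms(1) by blast
  obtain B where B: "feasible k X B" "g B = g A"
    "\<And>T. feasible k X T \<Longrightarrow> g T = g A \<Longrightarrow> nat (sz B) \<le> nat (sz T)"
    using ex_has_least_nat[of "\<lambda>T. feasible k X T \<and> g T = g A" A "\<lambda>T. nat (sz T)"] A(1) by blast
  have g: "int (g T) = sz (T \<uplus> X) - sz T" if "feasible k X T" for T
    using that assms(2) sz_sumset_ge by (simp add: g_def feasible_def)
  have "atom k X B (int (g B))"
    unfolding atom_def iso_ge_def
  proof (intro conjI allI impI)
    show "feasible k X B" by (rule B(1))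
    show "sz (B \<uplus> X) = sz B + int (g B)" using g[OF B(1)] by simp
    fix T assume T: "feasible k X T"
    show "sz T + int (g B) \<le> sz (T \<uplus> X)" using g[OF T] A(2)[OF T] B(2) by linarith
    assume "sz (T \<uplus> X) = sz T + int (g B)"
    then have "g T = g A" using g[OF T] B(2) by simp
    then show "sz B \<le> sz T" using B(3)[OF T] by (simp add: nat_le_eq_zle)
  qed
  moreover have "int (g B) \<le> b" using g[OF assms(1)] A(2)[OF assms(1)] B(2) assms(3) by linarith
  ultimately show thesis using that by blast
qed

lemma atomD:
  assumes "atom k X A c"
  shows "feasible k X A" "periodic A" "k \<le> sz A" "sz (A \<uplus> X) \<le> p - k" "sz (A \<uplus> X) = sz A + c" "iso_ge k X c"
  using assms by (auto simp: atom_def feasible_def)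

text \<open>The negated complement of \<open>A + X\<close> is again a fragment.\<close>

lemma atom_small:
  assumes "atom k X A c" "periodic X"
  shows "2 * sz A + c \<le> p"
proof -
  note A = atomD[OF assms(1)]
  define D where "D = {z. - z \<in> - (A \<uplus> X)}"
  have D: "periodic D" "sz D = p - sz A - c"
    unfolding D_def using A(2,5) by (auto simp: periodic_reflect sz_reflect sz_Compl simp del: Compl_iff)
  \<comment> \<open>If \<open>- z\<close> were in \<open>A\<close>, then \<open>x - z\<close> would
    be in \<open>A + X\<close>.\<close>
  have sub: "D \<uplus> X \<subseteq> {z. - z \<in> - A}"
  proof
    fix z assume "z \<in> D \<uplus> X"
    then obtain x where x: "x \<in> X" "x - z \<notin> A \<uplus> X" by (auto simp: D_def mem_sumset)
    have "x - z - x = - z" by simp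
    then show "z \<in> {z. - z \<in> - A}" using x unfolding mem_sumset by (metis ComplI mem_Collect_eq)
  qed
  have le: "sz (D \<uplus> X) \<le> p - sz A"
    using sz_mono[OF sub] A(2) by (simp add: sz_reflect sz_Compl del: Compl_iff)
  have f: "feasible k X D"
    unfolding feasible_def using D le A(3,4,5) by auto
  then have "sz (D \<uplus> X) = sz D + c" using iso_geD[OF A(6) f] le D(2) by simp
  then have "sz A \<le> sz D" using assms(1) f by (auto simp: atom_def)
  then show ?thesis using D(2) by simp
qed

text \<open>Submodularity, with the growth of \<open>S \<union> T\<close> bounded below. The two
  size conditions give \<open>sz (S \<union> T) + c \<le> p + 1 - k\<close>, so this bound is the
  full \<open>c\<close> even if the union is not feasible.\<close>

lemma fragment_Int:
  assumes "iso_ge k X c" "feasible k X S" "feasible k X T"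
    and "sz (S \<uplus> X) \<le> sz S + c" "sz (T \<uplus> X) \<le> sz T + c"
    and "sz S + sz T + c \<le> p + 1" "k \<le> sz (S \<inter> T)"
  shows "sz ((S \<inter> T) \<uplus> X) = sz (S \<inter> T) + c" "feasible k X (S \<inter> T)"
proof -
  have per: "periodic S" "periodic T" using assms(2,3) by (auto simp: feasible_def)
  show f: "feasible k X (S \<inter> T)"
    using assms(2) per assms(7) by (rule_tac feasible_subset) auto
  have u: "min (sz (S \<union> T) + c) (p - k + 1) \<le> sz ((S \<union> T) \<uplus> X)"
    using assms(2) per by (intro iso_ge_large[OF assms(1)]) (auto simp: feasible_def intro: order_trans sz_mono)
  have "sz ((S \<inter> T) \<uplus> X) \<le> sz (S \<inter> T) + c"
    using u submodular[of S T X] sz_Un_Int[of S T] assms(4-7) by linarith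
  then show "sz ((S \<inter> T) \<uplus> X) = sz (S \<inter> T) + c"
    using iso_geD[OF assms(1) f] by simp
qed

text \<open>If \<open>S\<close> is feasible, it is too small to be a fragment. If it is not, its
  sumset has more than \<open>p - k\<close> elements and hence more than
  \<open>A + X\<close>.\<close>

lemma atom_strict:
  assumes "atom k X A c" "periodic S" "k \<le> sz S" "sz S < sz A"
  shows "sz S + c + 1 \<le> sz (S \<uplus> X)"
proof (cases "feasible k X S")
  case True
  then show ?thesis using assms iso_geD[of k X c S] by (force simp: atom_def)
next
  case False
  then show ?thesis using assms atomD(4,5)[OF assms(1)] by (auto simp: feasible_def)
qed

text \<open>The intersection property of atoms: a translate of \<open>A\<close> is a fragment too,
  so \<open>k\<close> common residues would make the intersection a fragment smaller than
  \<open>A\<close>. \<open>atom_small\<close> supplies the size condition of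
  \<open>fragment_Int\<close>.\<close>

lemma atom_Int_shift:
  assumes "atom k X A c" "periodic X" "X \<noteq> {}" "1 \<le> k" "\<not> p dvd g"
  shows "sz (A \<inter> shift g A) \<le> k - 1"
proof (rule ccontr)
  assume "\<not> ?thesis"
  then have ge: "k \<le> sz (A \<inter> shift g A)" by simp
  note A = atomD[OF assms(1)]
  have s: "feasible k X (shift g A)" "sz (shift g A \<uplus> X) = sz A + c"
    using A by (auto simp: feasible_def shift_sumset)
  have "sz A \<le> sz (A \<uplus> X)" using A assms(3) sz_sumset_ge by blast
  then have "sz (A \<inter> shift g A) < sz A"
    using A assms(4,5) by (intro sz_Int_shift_less) auto
  moreover have "sz ((A \<inter> shift g A) \<uplus> X) = sz (A \<inter> shift g A) + c"
    using A s atom_small[OF assms(1,2)] ge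
    by (intro fragment_Int(1)[OF A(6)]) auto
  ultimately show False using atom_strict[OF assms(1) _ ge] A(2) by auto
qed

text \<open>The dual of an atom is at least as large as the atom.\<close>

lemma atom_feasible_Suc:
  assumes "atom k X A c" "periodic X" "k + 1 \<le> sz A"
  shows "feasible (k + 1) X A"
  using atomD[OF assms(1)] atom_small[OF assms(1,2)] assms(3) by (auto simp: feasible_def)

text \<open>A \<open>k\<close>-atom of growth below \<open>c\<close> with more than \<open>k\<close>
  elements would be feasible for \<open>k + 1\<close> and violate the bound there, so it has exactly
  \<open>k\<close>.\<close>

lemma iso_ge_pred:
  assumes "iso_ge (k + 1) X c" "\<not> iso_ge k X c" "periodic X" "X \<noteq> {}"
  obtains M d where "atom k X M d" "sz M = k" "d < c"
proof -
  obtain S where S: "feasible k X S" "sz (S \<uplus> X) < sz S + c"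
    using assms(2) by (auto simp: iso_ge_def not_le)
  obtain M d where M: "atom k X M d" "d \<le> c - 1"
    using ex_atom[OF S(1) assms(4), of "c - 1"] S(2) by auto
  have "\<not> k + 1 \<le> sz M"
    using iso_geD[OF assms(1) atom_feasible_Suc[OF M(1) assms(3)]] atomD(5)[OF M(1)] M(2) by linarith
  then show thesis using that[of M d] M atomD(3)[OF M(1)] by simp
qed

section \<open>Sums with a progression \<open>{0, d, ..., t d}\<close>\<close>

definition block :: "int \<Rightarrow> nat \<Rightarrow> int set \<Rightarrow> int set" where
  "block d t V = {z. \<exists>i. 0 \<le> i \<and> i \<le> int t \<and> z - i * d \<in> V}"

lemma block_0 [simp]: "block d 0 V = V"
  by (auto simp: block_def)

lemma block_Suc: "block d (Suc t) V = block d t V \<union> shift d (block d t V)"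
proof -
  have "z \<in> block d t V \<union> shift d (block d t V)" if z: "z \<in> block d (Suc t) V" for z
  proof -
    obtain i where i: "0 \<le> i" "i \<le> int (Suc t)" "z - i * d \<in> V" using z by (auto simp: block_def)
    show ?thesis
    proof (cases "i \<le> int t")
      case False
      then have "0 \<le> i - 1 \<and> i - 1 \<le> int t \<and> z - d - (i - 1) * d \<in> V" using i by (simp add: left_diff_distrib)
      then show ?thesis unfolding block_def shift_def by blast
    qed (use i in \<open>auto simp: block_def\<close>)
  qed
  moreover have "z \<in> block d (Suc t) V" if z: "z - d \<in> block d t V" for z
  proof -
    obtain i where i: "0 \<le> i" "i \<le> int t" "z - d - i * d \<in> V" using z by (auto simp: block_def)
    have "z - (i + 1) * d = z - d - i * d" by (simp add: algebra_simps)
    then have "z - (i + 1) * d \<in> V" using i(3) by metis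
    then have "0 \<le> i + 1 \<and> i + 1 \<le> int (Suc t) \<and> z - (i + 1) * d \<in> V" using i(1,2) by simp
    then show ?thesis unfolding block_def by blast
  qed
  moreover have "block d t V \<subseteq> block d (Suc t) V" by (force simp: block_def)
  ultimately show ?thesis unfolding shift_def by blast
qed

lemma periodic_block [simp]: "periodic V \<Longrightarrow> periodic (block d t V)"
  by (induction t) (simp_all add: block_Suc)

text \<open>A new point has the form \<open>v + (t + 1) d\<close> with \<open>v\<close> in
  \<open>V\<close> but \<open>v + d\<close> outside, and
  \<open>sz V - sz (V \<inter> shift d V)\<close> counts these ends of
  \<open>d\<close>-runs.\<close>

lemma sz_block_Suc:
  assumes "periodic V"
  shows "sz (block d (Suc t) V) \<le> sz (block d t V) + (sz V - sz (V \<inter> shift d V))"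
proof -
  let ?E = "shift ((int t + 1) * d) (V - shift (- d) V)"
  have "block d (Suc t) V \<subseteq> block d t V \<union> ?E"
  proof
    fix z assume z: "z \<in> block d (Suc t) V"
    show "z \<in> block d t V \<union> ?E"
    proof (cases "z \<in> block d t V")
      case False
      obtain i where i: "0 \<le> i" "i \<le> int t + 1" "z - i * d \<in> V" using z by (auto simp: block_def)
      have n: "z - j * d \<notin> V" if "0 \<le> j" "j \<le> int t" for j using False that by (auto simp: block_def)
      have it: "i = int t + 1" using i n[of i] by force
      have "z - (int t + 1) * d - - d = z - int t * d" by (simp add: algebra_simps)
      then have "z - (int t + 1) * d - - d \<notin> V" using n[of "int t"] by (metis of_nat_0_le_iff order_refl)
      then show ?thesis using i(3) unfolding it shift_def by blast
    qed simp
  qed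
  then have "sz (block d (Suc t) V) \<le> sz (block d t V \<union> ?E)"
    by (rule sz_mono)
  also have "\<dots> \<le> sz (block d t V) + sz ?E"
    using sz_Un_Int[of "block d t V" ?E] sz_nonneg[of "block d t V \<inter> ?E"] by linarith
  also have "sz ?E = sz V - sz (V \<inter> shift (- d) V)"
    using assms by (simp add: sz_Diff)
  also have "V \<inter> shift (- d) V = shift (- d) (V \<inter> shift d V)" by auto
  finally show ?thesis using assms by simp
qed

lemma sz_block_le:
  assumes "periodic V"
  shows "sz (block d t V) \<le> sz V + int t * (sz V - sz (V \<inter> shift d V))"
proof (induction t)
  case (Suc t)
  then show ?case using sz_block_Suc[OF assms, of d t] by (simp add: algebra_simps)
qed simp

text \<open>Each step gains a point until all residues are covered, since no proper nonempty set is
  invariant under translation by \<open>d\<close>.\<close>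

lemma sz_block_ge:
  assumes "periodic V" "0 < sz V" "\<not> p dvd d"
  shows "min p (sz V + int t) \<le> sz (block d t V)"
proof (induction t)
  case (Suc t)
  show ?case
  proof (cases "sz (block d t V) < p")
    case True
    then have "sz (block d t V) + 1 \<le> sz (block d (Suc t) V)"
      unfolding block_Suc using Suc assms p_gt_1 by (intro sz_Un_shift_ge) auto
    then show ?thesis using Suc True by simp
  next
    case False
    then show ?thesis using sz_mono[of "block d t V" "block d (Suc t) V"] by (simp add: block_Suc)
  qed
qed simp

lemma block_sumset: "block d t (V \<uplus> X) = block d t V \<uplus> X"
proof (intro equalityI subsetI)
  fix z assume "z \<in> block d t (V \<uplus> X)"
  then obtain i x where i: "0 \<le> i" "i \<le> int t" "x \<in> X" "z - i * d - x \<in> V" by (auto simp: block_def mem_sumset)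
  have "z - x - i * d = z - i * d - x" by simp
  then have "z - x - i * d \<in> V" using i(4) by metis
  then show "z \<in> block d t V \<uplus> X" using i unfolding block_def mem_sumset by blast
next
  fix z assume "z \<in> block d t V \<uplus> X"
  then obtain i x where i: "0 \<le> i" "i \<le> int t" "x \<in> X" "z - x - i * d \<in> V" by (auto simp: block_def mem_sumset)
  have "z - i * d - x = z - x - i * d" by simp
  then have "z - i * d - x \<in> V" using i(4) by metis
  then show "z \<in> block d t (V \<uplus> X)" using i unfolding block_def mem_sumset by blast
qed

lemma block_run:
  assumes "z \<in> block 1 t V"
  obtains b where "b \<le> z" "z \<le> b + int t" "{b..b + int t} \<subseteq> block 1 t V"
proof -
  obtain i where i: "0 \<le> i" "i \<le> int t" "z - i \<in> V" using assms by (auto simp: block_def)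
  have "w \<in> block 1 t V" if "w \<in> {z - i..z - i + int t}" for w
    using that i(3) by (auto simp: block_def intro!: exI[of _ "w - (z - i)"])
  then show thesis using i by (intro that[of "z - i"]) auto
qed

lemma block_eq_UNIV:
  assumes "periodic V" "V \<noteq> {}"
  shows "block 1 (nat p) V = UNIV"
proof -
  have "\<not> p dvd 1" using p_gt_1 by (simp add: zdvd1_eq)
  then have "p \<le> sz (block 1 (nat p) V)"
    using sz_block_ge[of V 1 "nat p"] assms sz_pos_iff p_gt_1 by auto
  then show ?thesis using assms sz_subset_eq[of "block 1 (nat p) V" UNIV] by simp
qed

section \<open>Runs\<close>

text \<open>Runs are maximal intervals of integers, so a start is an integer and not a residue, and
  offsets within runs make sense.\<close>

definition run_start :: "int set \<Rightarrow> int \<Rightarrow> int \<Rightarrow> bool" where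
  "run_start S z s \<longleftrightarrow> s \<le> z \<and> {s..z} \<subseteq> S \<and> s - 1 \<notin> S"

lemma run_start_unique: "run_start S z s \<Longrightarrow> run_start S z t \<Longrightarrow> s = t"
proof (induction s t rule: linorder_wlog)
  case (le s t)
  show ?case
  proof (rule ccontr)
    assume "s \<noteq> t"
    then have "t - 1 \<in> {s..z}" using le by (auto simp: run_start_def)
    then have "t - 1 \<in> S" using le unfolding run_start_def by blast
    then show False using le by (simp add: run_start_def)
  qed
qed simp

lemma run_start_exists:
  assumes "periodic S" "z \<in> S" "S \<noteq> UNIV"
  obtains s where "run_start S z s"
proof -
  obtain w where w: "w \<notin> S" using assms(3) by blast
  \<comment> \<open>\<open>v\<close> is the representative of \<open>w\<close> among the
    \<open>p\<close> integers ending at \<open>z\<close>, so the search to the left of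
    \<open>z\<close> stops.\<close>
  define v where "v = z - (z - w) mod p"
  have "[v = w] (mod p)" by (simp add: v_def cong_def mod_simps)
  then have v: "v \<notin> S" "v \<le> z" using w p_gt_1 periodic_cong[OF assms(1)] by (auto simp: v_def)
  define i where "i = (LEAST i. z - int i \<notin> S)"
  have ex: "z - int (nat (z - v)) \<notin> S" using v by simp
  have i: "z - int i \<notin> S" unfolding i_def by (rule LeastI[of _ "nat (z - v)"]) (rule ex)
  have j: "z - int j \<in> S" if "j < i" for j using not_less_Least that unfolding i_def by blast
  have "i \<noteq> 0" using i assms(2) by (metis of_nat_0 diff_zero)
  moreover have "y \<in> S" if "y \<in> {z - int i + 1..z}" for y
    using j[of "nat (z - y)"] that by auto
  ultimately have "run_start S z (z - int i + 1)" using i by (auto simp: run_start_def)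
  then show thesis by (rule that)
qed

lemma run_start_shift:
  assumes "periodic S" "run_start S z s"
  shows "run_start S (z + k * p) (s + k * p)"
  unfolding run_start_def
proof (intro conjI subsetI)
  fix y assume "y \<in> {s + k * p..z + k * p}"
  then have "y - k * p \<in> S" using assms(2) by (auto simp: run_start_def)
  then show "y \<in> S" using periodic_mult[OF assms(1), of "y - k * p" k] by simp
next
  show "s + k * p - 1 \<notin> S"
    using assms(2) periodic_mult[OF assms(1), of "s - 1" k] by (simp add: run_start_def algebra_simps)
qed (use assms(2) in \<open>auto simp: run_start_def\<close>)

lemma run_end_exists:
  assumes "periodic S" "S \<noteq> UNIV"
  obtains e where "z \<le> e" "e \<notin> S" "{z..<e} \<subseteq> S"
proof -
  obtain w where w: "w \<notin> S" using assms(2) by blast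
  define i where "i = (LEAST i. z + int i \<notin> S)"
  have "[z + (w - z) mod p = w] (mod p)" by (simp add: cong_def mod_simps)
  then have "z + int (nat ((w - z) mod p)) \<notin> S" using w periodic_cong[OF assms(1)] p_gt_1 by simp
  then have i: "z + int i \<notin> S" unfolding i_def by (rule LeastI)
  have j: "z + int j \<in> S" if "j < i" for j using not_less_Least that unfolding i_def by blast
  have "y \<in> S" if "y \<in> {z..<z + int i}" for y
    using j[of "nat (y - z)"] that by auto
  then show thesis using i by (intro that[of "z + int i"]) auto
qed

text \<open>The last \<open>\<delta>\<close> points of the run move into the following gap, or beyond it.\<close>

lemma long_run_translate:
  assumes S: "periodic S" "S \<noteq> UNIV" and run: "{z..z + \<delta>} \<subseteq> S" and L: "0 \<le> L" "L \<le> \<delta>" "L < p"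
    and gap: "\<And>z. z \<notin> S \<Longrightarrow> \<exists>b. b \<le> z \<and> z < b + L \<and> {b..<b + L} \<inter> S = {}"
  shows "sz (S \<inter> shift (- \<delta>) S) + L \<le> sz S"
proof -
  obtain e where e: "z \<le> e" "e \<notin> S" "{z..<e} \<subseteq> S" using run_end_exists[OF S] by blast
  have ze: "z + \<delta> < e" using e run by (meson atLeastAtMost_iff not_le subsetD)
  obtain d where d: "d \<le> e" "e < d + L" "{d..<d + L} \<inter> S = {}" using gap[OF e(2)] by blast
  have "\<not> d \<le> e - 1"
  proof
    assume "d \<le> e - 1"
    then have "e - 1 \<in> {d..<d + L}" "e - 1 \<in> {z..<e}" using d(2) ze L by simp_all
    then show False using d(3) e(3) by blast
  qed
  then have de: "d = e" using d by simp
  \<comment> \<open>These \<open>L\<close> points lie in the run, as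
    \<open>L \<le> \<delta>\<close>, and adding \<open>\<delta>\<close> carries them onto the gap
    \<open>{e..<e + L}\<close>; they are incongruent because \<open>L < p\<close>.\<close>
  let ?T = "residues_of {e - \<delta>..<e - \<delta> + L}"
  have "\<not> p dvd u - v" if "u \<in> {e - \<delta>..<e - \<delta> + L}" "v \<in> {e - \<delta>..<e - \<delta> + L}" "u \<noteq> v" for u v
  proof
    assume "p dvd u - v"
    then have "\<bar>p\<bar> \<le> \<bar>u - v\<bar>" using that(3) by (intro dvd_imp_le_int) auto
    then show False using that L by auto
  qed
  then have T: "sz ?T = L" using sz_residues_of[of "{e - \<delta>..<e - \<delta> + L}"] L by simp
  have "?T \<subseteq> S" using e ze L by (intro residues_of_subset S) auto
  moreover have "?T \<subseteq> - shift (- \<delta>) S"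
  proof (intro residues_of_subset subsetI)
    fix u assume "u \<in> {e - \<delta>..<e - \<delta> + L}"
    then have "u + \<delta> \<in> {d..<d + L}" using de by auto
    then show "u \<in> - shift (- \<delta>) S" using d(3) by auto
  qed (use S in simp)
  ultimately have "?T \<subseteq> S - shift (- \<delta>) S" by blast
  then have "sz ?T \<le> sz (S - shift (- \<delta>) S)" by (rule sz_mono)
  then show ?thesis using T by (simp add: sz_Diff)
qed

text \<open>For every \<open>x\<close> in \<open>X\<close> the runs of \<open>Y - x\<close> lie in distinct runs of \<open>\<Psi>\<close>: otherwise \<open>\<Psi>\<close> would contain a
  translate of \<open>- X\<close> together with its shift by some \<open>\<delta> \<ge> L\<close>, although this shift moves at least \<open>L\<close>
  points of \<open>\<Psi>\<close> out of \<open>\<Psi>\<close>. Let \<open>O x\<close> be the sum over the runs of \<open>Y\<close> of their offsets within those of \<open>\<Psi>\<close>.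
  Summing the positions of the starting points shows that \<open>q x + O x\<close> does not depend on \<open>x\<close>
  modulo \<open>p\<close>, and \<open>0 \<le> O x \<le> |\<Psi>| - |Y|\<close>.\<close>

lemma runs_progression:
  fixes L q :: int
  assumes per: "periodic X" "periodic Y" "periodic \<Psi>"
    and sub: "\<And>x y. x \<in> X \<Longrightarrow> y \<in> Y \<Longrightarrow> y - x \<in> \<Psi>"
    and ne: "\<Psi> \<noteq> UNIV"
    and q: "sz (\<Psi> - shift 1 \<Psi>) = q" "sz (Y - shift 1 Y) = q"
    and gap\<Psi>: "\<And>z. z \<notin> \<Psi> \<Longrightarrow> \<exists>b. b \<le> z \<and> z < b + L \<and> {b..<b + L} \<inter> \<Psi> = {}"
    and gapY: "\<And>z. z \<notin> Y \<Longrightarrow> \<exists>b. b \<le> z \<and> z < b + L \<and> {b..<b + L} \<inter> Y = {}"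
    and L0: "0 \<le> L" and L: "sz \<Psi> - sz X < L" "L < p"
  obtains c where "\<And>x. x \<in> X \<Longrightarrow> \<exists>i. 0 \<le> i \<and> i \<le> sz \<Psi> - sz Y \<and> [q * x = c - i] (mod p)"
proof -
  define st where "st z = (THE s. run_start \<Psi> z s)" for z
  have st: "run_start \<Psi> z (st z)" if "z \<in> \<Psi>" for z
    using run_start_exists[OF per(3) that ne] theI' run_start_unique unfolding st_def by metis
  have st_eq: "st z = s" if "run_start \<Psi> z s" for z s
    using that run_start_unique unfolding st_def by (metis the_equality)
  have st_per: "st (z + k * p) = st z + k * p" if "z \<in> \<Psi>" for z k
    using st_eq run_start_shift[OF per(3) st[OF that]] by blast
  have st_same: "st w = st z" if "z \<in> \<Psi>" "st z \<le> w" "w \<le> z" for w z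
    using st[OF that(1)] that by (intro st_eq) (auto simp: run_start_def)
  have st_up: "st w = st z" if "z \<in> \<Psi>" "z \<le> w" "{z..w} \<subseteq> \<Psi>" for w z
  proof (rule st_eq, unfold run_start_def, intro conjI)
    have s: "st z \<le> z" "{st z..z} \<subseteq> \<Psi>" "st z - 1 \<notin> \<Psi>" using st[OF that(1)] by (auto simp: run_start_def)
    show "st z \<le> w" "st z - 1 \<notin> \<Psi>" using s that by auto
    show "{st z..w} \<subseteq> \<Psi>"
    proof
      fix y assume "y \<in> {st z..w}"
      then show "y \<in> \<Psi>" using s(2) that(3) by (cases "y \<le> z") auto
    qed
  qed
  have inj: "y = y'" if x: "x \<in> X" and y: "y \<in> Y - shift 1 Y" "y' \<in> Y - shift 1 Y"
    and s: "st (y - x) = st (y' - x)" for x y y'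
    using y s
  proof (induction y y' rule: linorder_wlog)
    case (le y y')
    show ?case
    proof (rule ccontr)
      assume "y \<noteq> y'"
      define \<delta> where "\<delta> = y' - y"
      have \<delta>: "\<delta> > 0" using le \<open>y \<noteq> y'\<close> by (simp add: \<delta>_def)
      have y'\<Psi>: "y' - x \<in> \<Psi>" and y\<Psi>: "y - x \<in> \<Psi>" using sub x le by auto
      \<comment> \<open>\<open>y'\<close> is preceded by a gap of \<open>Y\<close>, which lies after \<open>y\<close>\<close>
      have "y' - 1 \<notin> Y" using le by simp
      then obtain b where b: "b \<le> y' - 1" "y' - 1 < b + L" "{b..<b + L} \<inter> Y = {}" using gapY by blast
      have "y \<notin> {b..<b + L}" "y' \<notin> {b..<b + L}" using b(3) le by blast+
      then have L\<delta>: "L \<le> \<delta>" using b(1,2) le(1) \<delta> by (simp add: \<delta>_def)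
      let ?Z = "{w. y - w \<in> X}"
      have "{y - x..y - x + \<delta>} \<subseteq> \<Psi>"
      proof
        fix w assume w: "w \<in> {y - x..y - x + \<delta>}"
        have "st (y' - x) \<le> y - x" using st[OF y\<Psi>] le(4) by (simp add: run_start_def)
        then have "w \<in> {st (y' - x)..y' - x}" using w by (auto simp: \<delta>_def)
        then show "w \<in> \<Psi>" using st[OF y'\<Psi>] by (auto simp: run_start_def)
      qed
      then have "sz (\<Psi> \<inter> shift (- \<delta>) \<Psi>) + L \<le> sz \<Psi>"
        using L0 L\<delta> L gap\<Psi> per ne by (intro long_run_translate)
      moreover have "sz ?Z \<le> sz (\<Psi> \<inter> shift (- \<delta>) \<Psi>)"
      proof (rule sz_mono, rule subsetI)
        fix w assume "w \<in> ?Z"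
        then have "y - (y - w) \<in> \<Psi>" "y' - (y - w) \<in> \<Psi>" using sub le by blast+
        then show "w \<in> \<Psi> \<inter> shift (- \<delta>) \<Psi>" by (simp add: \<delta>_def algebra_simps)
      qed
      moreover have "sz ?Z = sz X" using sz_dilate[of X "-1" y] per by simp
      ultimately show False using L by simp
    qed
  next
    case (sym y y')
    then show ?case by metis
  qed
  define Y0 where "Y0 = (Y - shift 1 Y) \<inter> {0..<p}"
  define P0 where "P0 = (\<Psi> - shift 1 \<Psi>) \<inter> {0..<p}"
  have cards: "card Y0 = nat q" "card P0 = nat q" "finite Y0" "finite P0"
    using q by (auto simp: Y0_def P0_def sz_def)
  \<comment> \<open>\<open>inj\<close> for starts that agree only modulo \<open>p\<close>: moving
    \<open>y'\<close> by a multiple of \<open>p\<close> makes them equal, and either alternative of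
    the last premise makes that multiple zero.\<close>
  have inj0: "y = y'" if x: "x \<in> X" and y: "y \<in> Y0" "y' \<in> Y - shift 1 Y"
    and s: "[st (y - x) = st (y' - x)] (mod p)" and p: "y' \<in> {0..<p} \<or> st (y - x) = st (y' - x)" for x y y'
  proof -
    obtain k where k: "st (y - x) = st (y' - x) + k * p"
      using s by (metis cong_iff_lin cong_sym mult.commute)
    have "y' - x \<in> \<Psi>" using sub x y by simp
    then have "st (y - x) = st ((y' + k * p) - x)" using k st_per[of "y' - x" k] by (simp add: algebra_simps)
    moreover have "y' + k * p \<in> Y - shift 1 Y"
      using y(2) per(2) periodic_mult[of "Y - shift 1 Y" y' k] by simp
    ultimately have *: "y = y' + k * p" using inj[OF x, of y "y' + k * p"] y(1) by (simp add: Y0_def)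
    show ?thesis
    proof (cases "y' \<in> {0..<p}")
      case True
      then have "y mod p = y" "y' mod p = y'" using y(1) by (auto simp: Y0_def)
      then show ?thesis using * by (metis mod_mult_self1)
    next
      case False
      then have "st (y - x) = st (y' - x)" using p by blast
      then have "k * p = 0" using k by simp
      then show ?thesis using * by simp
    qed
  qed
  define O' where "O' x = (\<Sum>y\<in>Y0. (y - x) - st (y - x))" for x
  have main: "0 \<le> O' x" "O' x \<le> sz \<Psi> - sz Y" "[q * x = (\<Sum>Y0) - (\<Sum>P0) - O' x] (mod p)"
    if x: "x \<in> X" for x
  proof -
    have mem: "y - x \<in> \<Psi>" if "y \<in> Y0" for y using that sub x by (auto simp: Y0_def)
    have stle: "st (y - x) \<le> y - x" if "y \<in> Y0" for y using st[OF mem[OF that]] by (simp add: run_start_def)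
    then show "0 \<le> O' x" unfolding O'_def by (intro sum_nonneg) simp
    have injm: "inj_on (\<lambda>y. st (y - x) mod p) Y0"
      using inj0[OF x] by (intro inj_onI) (auto simp: Y0_def cong_def)
    \<comment> \<open>Distinct runs of \<open>Y - x\<close> lie in distinct runs of
      \<open>\<Psi>\<close> and there are \<open>q\<close> of each, so every run of
      \<open>\<Psi>\<close> is used once and the starts can be summed.\<close>
    have "(\<lambda>y. st (y - x) mod p) ` Y0 = P0"
    proof (rule card_subset_eq[OF cards(4)])
      show "(\<lambda>y. st (y - x) mod p) ` Y0 \<subseteq> P0"
      proof (rule image_subsetI)
        fix y assume "y \<in> Y0"
        then have "run_start \<Psi> (y - x) (st (y - x))" using st mem by blast
        then have "st (y - x) \<in> \<Psi> - shift 1 \<Psi>" by (auto simp: run_start_def)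
        then show "st (y - x) mod p \<in> P0"
          using periodic_mod[of "\<Psi> - shift 1 \<Psi>"] per p_gt_1 by (simp add: P0_def)
      qed
      show "card ((\<lambda>y. st (y - x) mod p) ` Y0) = card P0" using card_image[OF injm] cards by simp
    qed
    then have "(\<Sum>P0) = (\<Sum>y\<in>Y0. st (y - x) mod p)" using sum.reindex[OF injm, of "\<lambda>y. y"] by (simp add: o_def)
    moreover have "[(\<Sum>y\<in>Y0. st (y - x) mod p) = (\<Sum>y\<in>Y0. st (y - x))] (mod p)"
      by (simp add: cong_def mod_sum_eq)
    moreover have "O' x = (\<Sum>Y0) - q * x - (\<Sum>y\<in>Y0. st (y - x))"
      using cards q sz_nonneg[of "Y - shift 1 Y"] by (simp add: O'_def sum_subtractf)
    ultimately have "[(\<Sum>P0) = (\<Sum>Y0) - q * x - O' x] (mod p)" by simp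
    then have "[(\<Sum>P0) + (q * x - (\<Sum>P0)) = (\<Sum>Y0) - q * x - O' x + (q * x - (\<Sum>P0))] (mod p)"
      by (intro cong_add cong_refl)
    then show "[q * x = (\<Sum>Y0) - (\<Sum>P0) - O' x] (mod p)" by (simp add: algebra_simps)
    \<comment> \<open>\<open>B\<close> lists the points that precede some \<open>y - x\<close> in
      its run of \<open>\<Psi>\<close>. There are \<open>O' x\<close> of them, incongruent, and all
      outside \<open>Y - x\<close>, which bounds \<open>O' x\<close>.\<close>
    define B where "B = (SIGMA y:Y0. {st (y - x)..<y - x})"
    have stB: "st j = st (y - x)" "j \<in> \<Psi>" if "y \<in> Y0" "j \<in> {st (y - x)..<y - x}" for y j
      using st_same[OF mem[OF that(1)], of j] st[OF mem[OF that(1)]] that(2) by (auto simp: run_start_def)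
    have "inj_on (\<lambda>b. snd b mod p) B"
    proof (rule inj_onI, clarify)
      fix y j y' j' assume "(y, j) \<in> B" "(y', j') \<in> B" and e: "snd (y, j) mod p = snd (y', j') mod p"
      then have B: "y \<in> Y0" "j \<in> {st (y - x)..<y - x}" "y' \<in> Y0" "j' \<in> {st (y' - x)..<y' - x}"
        by (auto simp: B_def)
      have "[j = j'] (mod p)" using e by (simp add: cong_def)
      then obtain k where k: "j = j' + k * p" by (metis cong_iff_lin cong_sym mult.commute)
      then have "st j = st j' + k * p" using st_per stB B by blast
      then have k': "st (y - x) = st (y' - x) + k * p" using stB B by metis
      then have "[st (y - x) = st (y' - x)] (mod p)" by (simp add: cong_def)
      then have yy: "y = y'" using inj0[OF x B(1), of y'] B(3) by (auto simp: Y0_def)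
      then have "k = 0" using k' p_gt_1 by simp
      then show "y = y' \<and> j = j'" using yy k by simp
    qed
    moreover have "(\<lambda>b. snd b mod p) ` B \<subseteq> (\<Psi> - shift (- x) Y) \<inter> {0..<p}"
    proof (rule image_subsetI)
      fix b assume "b \<in> B"
      then obtain y j where b: "b = (y, j)" "y \<in> Y0" "j \<in> {st (y - x)..<y - x}" by (auto simp: B_def)
      \<comment> \<open>Otherwise the run of \<open>Y\<close> through \<open>j + x\<close> would
        start before \<open>y\<close> and yet, translated by \<open>- x\<close>, lie in the same run
        of \<open>\<Psi>\<close> as \<open>y - x\<close>.\<close>
      have "j + x \<notin> Y"
      proof
        assume jx: "j + x \<in> Y"
        have "Y \<noteq> UNIV"
        proof
          assume "Y = UNIV"
          then have "w \<in> \<Psi>" for w using sub[OF x, of "w + x"] by simp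
          then show False using ne by blast
        qed
        then obtain y0 where y0: "run_start Y (j + x) y0" using run_start_exists[OF per(2) jx] by blast
        have "{y0 - x..j} \<subseteq> \<Psi>"
        proof
          fix w assume "w \<in> {y0 - x..j}"
          then have "w + x \<in> Y" using y0 by (auto simp: run_start_def)
          then show "w \<in> \<Psi>" using sub[OF x] by force
        qed
        moreover have "y0 - x \<le> j" using y0 by (simp add: run_start_def)
        ultimately have "st j = st (y0 - x)" by (intro st_up) auto
        then have st0: "st (y - x) = st (y0 - x)" using stB(1)[OF b(2,3)] by (rule trans[OF sym, rotated])
        have "y0 \<in> Y - shift 1 Y" using y0 by (auto simp: run_start_def)
        then have "y = y0"
        proof (rule inj0[OF x b(2)])
          show "[st (y - x) = st (y0 - x)] (mod p)" unfolding st0 by (rule cong_refl)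
        qed (rule disjI2, rule st0)
        then show False using b(3) y0 by (auto simp: run_start_def)
      qed
      then have "j \<in> \<Psi> - shift (- x) Y" using stB(2)[OF b(2,3)] by simp
      then show "snd b mod p \<in> (\<Psi> - shift (- x) Y) \<inter> {0..<p}"
        using periodic_mod[of "\<Psi> - shift (- x) Y"] per p_gt_1 b(1) by simp
    qed
    ultimately have "int (card B) \<le> sz (\<Psi> - shift (- x) Y)"
      unfolding sz_def by (simp add: card_inj_on_le)
    moreover have "int (card B) = O' x"
      unfolding B_def O'_def using cards stle by (simp add: card_SigmaI)
    moreover have "sz (\<Psi> - shift (- x) Y) = sz \<Psi> - sz Y"
    proof -
      have "\<Psi> \<inter> shift (- x) Y = shift (- x) Y"
        using sub[OF x] by (auto, metis add_diff_cancel_right')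
      then show ?thesis using per by (simp add: sz_Diff)
    qed
    ultimately show "O' x \<le> sz \<Psi> - sz Y" by simp
  qed
  show thesis
  proof (rule that)
    fix x assume "x \<in> X"
    then show "\<exists>i. 0 \<le> i \<and> i \<le> sz \<Psi> - sz Y \<and> [q * x = (\<Sum>Y0) - (\<Sum>P0) - i] (mod p)"
      using main by (intro exI[of _ "O' x"] conjI)
  qed
qed

section \<open>Fragments and arithmetic progressions\<close>

text \<open>The case \<open>d = 1\<close>. Submodularity keeps the growth of the blocks of
  \<open>V\<close> at most \<open>c\<close> while they are feasible; shortly before feasibility
  fails, the complements have long gaps and \<open>runs_progression\<close> applies with
  \<open>L = 10\<close>.\<close>

lemma fragment_chain:
  assumes per: "periodic X" "periodic V" and X: "X \<noteq> {}" and iso: "iso_ge k X c" and k: "2 \<le> k" "k \<le> 3"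
    and V: "sz (V \<uplus> X) \<le> sz V + c" "k \<le> sz (V \<inter> shift 1 V)" "sz V - sz (V \<inter> shift 1 V) \<le> 3" "sz V \<le> 7"
    and c: "c + 42 \<le> p" "c \<le> sz X + 1"
  obtains q b where "1 \<le> q" "q \<le> 3" "\<And>x. x \<in> X \<Longrightarrow> \<exists>i. 0 \<le> i \<and> i \<le> c \<and> [q * x = b - i] (mod p)"
proof -
  define B where "B t = block 1 t V" for t
  define good where "good t \<longleftrightarrow> sz (B t \<uplus> X) \<le> p - k" for t
  have Bper [simp]: "periodic (B t)" for t using per by (simp add: B_def)
  have BSuc: "B (Suc t) = B t \<union> shift 1 (B t)" for t by (simp add: B_def block_Suc)
  have step: "sz (B (Suc t)) \<le> sz (B t) + 3" for t
    using sz_block_Suc[OF per(2), of 1 t] V(3) by (simp add: B_def)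
  have VB: "V \<subseteq> B t" for t
    by (induction t) (use BSuc in \<open>auto simp: B_def\<close>)
  have kB: "k \<le> sz (B t \<inter> shift 1 (B t))" for t
  proof -
    have "V \<inter> shift 1 V \<subseteq> B t \<inter> shift 1 (B t)" using VB[of t] by auto
    then show ?thesis using sz_mono V(2) order_trans by blast
  qed
  have kB': "k \<le> sz (B t)" for t
    using kB[of t] sz_mono[of "B t \<inter> shift 1 (B t)" "B t"] by simp
  \<comment> \<open>The intersection with the translate is feasible and grows by at least
    \<open>c\<close>, which leaves at most \<open>c\<close> for the union.\<close>
  have grow_Suc: "sz (B (Suc t) \<uplus> X) \<le> sz (B (Suc t)) + c" if "good t" "sz (B t \<uplus> X) \<le> sz (B t) + c" for t
  proof -
    have "feasible k X (B t)" using that(1) kB' by (simp add: feasible_def good_def)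
    then have "feasible k X (B t \<inter> shift 1 (B t))"
      using kB by (rule_tac feasible_subset) auto
    then have "sz (B t \<inter> shift 1 (B t)) + c \<le> sz ((B t \<inter> shift 1 (B t)) \<uplus> X)"
      by (rule iso_geD[OF iso])
    moreover have "sz (shift 1 (B t) \<uplus> X) = sz (B t \<uplus> X)" by (simp add: shift_sumset)
    ultimately show ?thesis
      using submodular[of "B t" "shift 1 (B t)" X] sz_Un_Int[of "B t" "shift 1 (B t)"] that(2) BSuc[of t] by simp
  qed
  have "\<not> good (nat p)"
  proof -
    have "V \<noteq> {}" using V(2) k by auto
    then have "B (nat p) = UNIV" using block_eq_UNIV per by (simp add: B_def)
    moreover have "UNIV \<uplus> X = UNIV" using X by (auto simp: mem_sumset)
    ultimately show ?thesis using k by (simp add: good_def)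
  qed
  define T where "T = (LEAST t. \<not> good t)"
  have T: "\<not> good T" unfolding T_def by (rule LeastI) (rule \<open>\<not> good (nat p)\<close>)
  have goodT: "good s" if "s < T" for s using not_less_Least that unfolding T_def by blast
  have grow: "sz (B t \<uplus> X) \<le> sz (B t) + c" if "t \<le> T" for t
    using that
  proof (induction t)
    case (Suc t)
    then show ?case using grow_Suc goodT by simp
  qed (use V in \<open>simp add: B_def\<close>)
  have B0: "sz (B 0) \<le> 7" using V by (simp add: B_def)
  have "sz (V \<uplus> X) \<le> p - k" using V(1,4) c(1) k(2) by linarith
  then have "good 0" by (simp add: good_def B_def)
  then have "T \<noteq> 0" using T by metis
  then have g1: "sz (B 1 \<uplus> X) \<le> sz (B 1) + c" using grow[of 1] by simp
  have "sz (B 1) \<le> 10" using step[of 0] B0 by simp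
  then have "good 1" unfolding good_def using g1 c(1) k(2) by linarith
  then have "T \<noteq> 1" using T by metis
  \<comment> \<open>Two steps before the first failure both \<open>B t\<close> and
    \<open>B (Suc t)\<close> are feasible, hence of growth exactly \<open>c\<close>; this gives the
    complements \<open>P\<close> and \<open>Y\<close> equally many runs.\<close>
  define t where "t = T - 2"
  have tT: "T = Suc (Suc t)" using \<open>T \<noteq> 0\<close> \<open>T \<noteq> 1\<close> by (simp add: t_def)
  have gt: "good t" "good (Suc t)" using goodT tT by auto
  have eq: "sz (B s \<uplus> X) = sz (B s) + c" if "s = t \<or> s = Suc t" for s
  proof -
    have "feasible k X (B s)" using gt that kB' by (auto simp: feasible_def good_def)
    then show ?thesis using iso_geD[OF iso] grow[of s] that tT by force
  qed
  have big: "p - k + 1 - c \<le> sz (B (Suc (Suc t)))"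
    using T grow[of T] tT by (simp add: good_def)
  have "sz (B s) \<le> 7 + 3 * int s" for s
  proof (induction s)
    case (Suc s)
    then show ?case using step[of s] by simp
  qed (use B0 in simp)
  \<comment> \<open>Here \<open>42\<close> enters: \<open>p - k + 1 - c \<ge> 40\<close>, while
    \<open>B (Suc (Suc t))\<close> has at most \<open>13 + 3 t\<close> residues. The gaps thus have
    at least ten points.\<close>
  from this[of "Suc (Suc t)"] have t9: "9 \<le> t" using big c k by simp
  define P where "P = - B t"
  define Y where "Y = - (B t \<uplus> X)"
  define q where "q = sz (B (Suc t)) - sz (B t)"
  have szB: "0 < sz (B t)" "sz (B t) < p"
    using kB'[of t] k gt(1) sz_sumset_ge[of "B t" X] X by (auto simp: good_def)
  have "\<not> p dvd 1" using p_gt_1 by (simp add: zdvd1_eq)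
  then have q: "1 \<le> q" "q \<le> 3"
    using sz_Un_shift_ge[of "B t" 1] szB step[of t] BSuc[of t] by (simp_all add: q_def)
  have gap: "\<exists>b. b \<le> z \<and> z < b + 10 \<and> {b..<b + 10} \<inter> S = {}" if "z \<notin> S" "- S = block 1 t U" for z S U
  proof -
    have "z \<in> block 1 t U" using that by blast
    then obtain b where b: "b \<le> z" "z \<le> b + int t" "{b..b + int t} \<subseteq> block 1 t U"
      by (rule block_run)
    let ?b = "max b (z - 9)"
    have "{?b..<?b + 10} \<subseteq> {b..b + int t}" using b t9 by auto
    then have "{?b..<?b + 10} \<inter> S = {}" using b that by blast
    then show ?thesis using b by (intro exI[of _ ?b]) auto
  qed
  have "\<exists>b. \<forall>x\<in>X. \<exists>i. 0 \<le> i \<and> i \<le> sz P - sz Y \<and> [q * x = b - i] (mod p)"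
  proof (rule runs_progression[of X Y P q 10])
    show "periodic X" "periodic Y" "periodic P" using per by (auto simp: Y_def P_def)
    show "y - x \<in> P" if "x \<in> X" "y \<in> Y" for x y using that by (auto simp: Y_def P_def mem_sumset)
    show "P \<noteq> UNIV" using szB(1) by (metis P_def Compl_UNIV_eq double_compl sz_empty less_irrefl)
    have "P \<inter> shift 1 P = - B (Suc t)" by (auto simp: P_def BSuc)
    then show "sz (P - shift 1 P) = q" by (simp add: sz_Diff sz_Compl P_def q_def)
    have "Y \<inter> shift 1 Y = - (B (Suc t) \<uplus> X)" by (auto simp: Y_def BSuc sumset_Un shift_sumset)
    then show "sz (Y - shift 1 Y) = q" using eq by (simp add: sz_Diff sz_Compl Y_def q_def)
    show "\<exists>b. b \<le> z \<and> z < b + 10 \<and> {b..<b + 10} \<inter> P = {}" if "z \<notin> P" for z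
      using gap[OF that, of V] by (simp add: P_def B_def)
    show "\<exists>b. b \<le> z \<and> z < b + 10 \<and> {b..<b + 10} \<inter> Y = {}" if "z \<notin> Y" for z
      using gap[OF that, of "V \<uplus> X"] by (simp add: Y_def B_def block_sumset)
    \<comment> \<open>Two further steps of at most \<open>3\<close> residues each lead from
      \<open>B t\<close> to at least \<open>p - k + 1 - c\<close>, so
      \<open>sz P \<le> c + 8 \<le> sz X + 9\<close>.\<close>
    show "sz P - sz X < 10"
      using big step[of t] step[of "Suc t"] c k by (simp add: P_def sz_Compl)
    show "10 < p" using c V(1) sz_sumset_ge[OF per(2) X] by simp
  qed (simp, blast)
  moreover have "sz P - sz Y = c" using eq by (simp add: P_def Y_def sz_Compl)
  ultimately show thesis using q that by metis
qed

section \<open>Dilations and progressions\<close>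

lemma dilate_inverse:
  assumes "periodic S" "[d * e = 1] (mod p)"
  shows "{z. e * (d * z) \<in> S} = S"
proof -
  have "[e * (d * z) = z] (mod p)" for z
    using cong_mult[OF assms(2) cong_refl[of z]] by (simp add: mult_ac)
  then show ?thesis using periodic_cong[OF assms(1)] by blast
qed

lemma periodic_dilate: "periodic S \<Longrightarrow> periodic {z. d * z \<in> S}"
  using periodic_mult[of S _ d] by (simp add: periodic_def distrib_left)

lemma dilate_sumset:
  assumes "periodic S" "periodic X" "[d * e = 1] (mod p)"
  shows "{z. d * z \<in> S \<uplus> X} = {z. d * z \<in> S} \<uplus> {z. d * z \<in> X}"
proof (intro equalityI subsetI)
  fix z assume "z \<in> {z. d * z \<in> S \<uplus> X}"
  then obtain x where x: "x \<in> X" "d * z - x \<in> S" by (auto simp: mem_sumset)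
  have c: "[d * (e * x) = x] (mod p)"
    using cong_mult[OF assms(3) cong_refl[of x]] by (simp add: mult_ac)
  have "d * (e * x) \<in> X" using periodic_cong[OF assms(2) c] x by simp
  moreover have "d * (z - e * x) \<in> S"
    using periodic_cong[OF assms(1) cong_diff[OF cong_refl[of "d * z"] c]] x by (simp add: algebra_simps)
  ultimately show "z \<in> {z. d * z \<in> S} \<uplus> {z. d * z \<in> X}" by (auto simp: mem_sumset)
next
  fix z assume "z \<in> {z. d * z \<in> S} \<uplus> {z. d * z \<in> X}"
  then obtain x where "d * x \<in> X" "d * (z - x) \<in> S" by (auto simp: mem_sumset)
  then show "z \<in> {z. d * z \<in> S \<uplus> X}" by (auto simp: mem_sumset right_diff_distrib)
qed

text \<open>Multiplying by the inverse \<open>e\<close> of \<open>d\<close> turns the difference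
  \<open>d\<close> into \<open>1\<close>. Then \<open>fragment_chain\<close> puts
  \<open>q e X\<close> into a progression of difference \<open>-1\<close>, and with \<open>f\<close>
  inverse to \<open>q\<close> the difference for \<open>X\<close> itself is
  \<open>- (d f)\<close>.\<close>

lemma fragment_progression:
  assumes per: "periodic X" "periodic V" and X: "X \<noteq> {}" and iso: "iso_ge k X c" and k: "2 \<le> k" "k \<le> 3"
    and d: "\<not> p dvd d"
    and V: "sz (V \<uplus> X) \<le> sz V + c" "k \<le> sz (V \<inter> shift d V)" "sz V - sz (V \<inter> shift d V) \<le> 3" "sz V \<le> 7"
    and c: "c + 42 \<le> p" "c \<le> sz X + 1"
  obtains u b where "\<not> p dvd u" "\<And>x. x \<in> X \<Longrightarrow> \<exists>i. 0 \<le> i \<and> i \<le> c \<and> [x = b + i * u] (mod p)"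
proof -
  obtain e where e: "[d * e = 1] (mod p)" using coprime_p[OF d] cong_solve_coprime_int by blast
  then have e': "[e * d = 1] (mod p)" by (simp add: mult.commute)
  have cop: "coprime d p" "coprime e p" using e e' coprime_iff_invertible_int by blast+
  define D where "D S = {z. d * z \<in> S}" for S
  have D: "periodic (D S)" "sz (D S) = sz S" if "periodic S" for S
    using that sz_dilate[OF that cop(1), of 0] periodic_dilate by (simp_all add: D_def)
  have DX: "D (S \<uplus> X) = D S \<uplus> D X" if "periodic S" for S
    unfolding D_def by (rule dilate_sumset[OF that per(1) e])
  have "D V \<inter> shift 1 (D V) = D (V \<inter> shift d V)" by (auto simp: D_def right_diff_distrib)
  then have DV: "sz (D V \<inter> shift 1 (D V)) = sz (V \<inter> shift d V)" using D per by simp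
  have "iso_ge k (D X) c"
    unfolding iso_ge_def
  proof (intro allI impI)
    fix S assume S: "feasible k (D X) S"
    define R where "R = {z. e * z \<in> S}"
    have pS: "periodic S" using S by (simp add: feasible_def)
    have pR: "periodic R" unfolding R_def by (rule periodic_dilate[OF pS])
    have DR: "D R = S" using dilate_inverse[OF pS e] by (simp add: D_def R_def)
    have "sz R = sz S" "sz (R \<uplus> X) = sz (S \<uplus> D X)"
      using D[OF pR] D[of "R \<uplus> X"] DX[OF pR] DR pR by auto
    then show "sz S + c \<le> sz (S \<uplus> D X)"
      using iso_geD[OF iso, of R] S pR by (simp add: feasible_def)
  qed
  moreover have "D X \<noteq> {}" using X D[OF per(1)] sz_pos_iff per by metis
  moreover have "sz (D V \<uplus> D X) \<le> sz (D V) + c"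
    using V D[of "V \<uplus> X"] D[of V] DX[of V] per by simp
  ultimately obtain q b where q: "1 \<le> q" "q \<le> 3"
    "\<And>x. x \<in> D X \<Longrightarrow> \<exists>i. 0 \<le> i \<and> i \<le> c \<and> [q * x = b - i] (mod p)"
    using fragment_chain[of "D X" "D V" k c] D per k V c DV by auto
  have "10 < p" using c V(1) sz_sumset_ge[OF per(2) X] by simp
  then have "\<not> p dvd q" using q zdvd_imp_le by force
  then obtain f where f: "[q * f = 1] (mod p)" using coprime_p cong_solve_coprime_int by blast
  then have "coprime f p" using coprime_iff_invertible_int by (metis mult.commute)
  then have "coprime (d * f) p" using cop by simp
  then have u: "\<not> p dvd - (d * f)"
    using p_gt_1 by (metis coprime_common_divisor dvd_minus_iff dvd_refl zdvd1_eq abs_of_pos less_irrefl zero_less_one order_less_trans)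
  have "\<exists>i. 0 \<le> i \<and> i \<le> c \<and> [x = d * f * b + i * - (d * f)] (mod p)" if "x \<in> X" for x
  proof -
    have dx: "[d * (e * x) = x] (mod p)" using cong_mult[OF e cong_refl[of x]] by (simp add: mult_ac)
    then have "e * x \<in> D X" using that periodic_cong[OF per(1)] by (simp add: D_def)
    then obtain i where i: "0 \<le> i" "i \<le> c" "[q * (e * x) = b - i] (mod p)" using q(3) by blast
    have "[x = 1 * (d * (e * x))] (mod p)" using dx by (simp add: cong_sym)
    also have "[1 * (d * (e * x)) = (q * f) * (d * (e * x))] (mod p)"
      using f by (intro cong_mult cong_refl) (rule cong_sym)
    also have "(q * f) * (d * (e * x)) = (q * (e * x)) * (d * f)" by (simp add: mult_ac)
    also have "[\<dots> = (b - i) * (d * f)] (mod p)" using i(3) by (intro cong_mult cong_refl)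
    also have "(b - i) * (d * f) = d * f * b + i * - (d * f)" by (simp add: algebra_simps)
    finally show ?thesis using i by blast
  qed
  then show thesis using u that by blast
qed

text \<open>The witness is \<open>0, u, ..., (j - 1) u\<close>; adding a progression of
  \<open>c + 1\<close> terms with the same difference gives at most \<open>j + c\<close>
  terms.\<close>

lemma progression_growth:
  assumes u: "\<not> p dvd u" and ap: "\<And>x. x \<in> X \<Longrightarrow> \<exists>i. 0 \<le> i \<and> i \<le> c \<and> [x = b + i * u] (mod p)"
    and X: "X \<noteq> {}" and j: "1 \<le> j" "j \<le> p"
  obtains T where "periodic T" "sz T = j" "sz (T \<uplus> X) \<le> j + c"
proof -
  let ?T = "residues_of ((\<lambda>i. i * u) ` {0..<j})"
  have c0: "0 \<le> c" using X ap by fastforce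
  have ninj: "\<not> p dvd x - y" if xy: "x \<in> (\<lambda>i. i * u) ` {0..<j}" "y \<in> (\<lambda>i. i * u) ` {0..<j}" "x \<noteq> y" for x y
  proof
    assume *: "p dvd x - y"
    obtain i k where ik: "x = i * u" "y = k * u" "i \<in> {0..<j}" "k \<in> {0..<j}" using xy by blast
    then have "p dvd (i - k) * u" using * by (simp add: left_diff_distrib)
    then have "p dvd i - k" using u prime_p prime_dvd_mult_iff by blast
    moreover have "i \<noteq> k" using ik xy by blast
    ultimately have "\<bar>p\<bar> \<le> \<bar>i - k\<bar>" by (intro dvd_imp_le_int) auto
    then show False using ik j by auto
  qed
  have "u \<noteq> 0" using u by auto
  then have "card ((\<lambda>i. i * u) ` {0..<j}) = nat j" by (subst card_image) (auto simp: inj_on_def)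
  then have T: "sz ?T = j" using sz_residues_of[of "(\<lambda>i. i * u) ` {0..<j}"] ninj j by auto
  have "?T \<uplus> X \<subseteq> residues_of ((\<lambda>i. b + i * u) ` {0..<j + c})"
  proof
    fix z assume "z \<in> ?T \<uplus> X"
    then obtain x i where x: "x \<in> X" "i \<in> {0..<j}" "[z - x = i * u] (mod p)"
      by (auto simp: mem_sumset residues_of_def)
    obtain k where k: "0 \<le> k" "k \<le> c" "[x = b + k * u] (mod p)" using ap[OF x(1)] by blast
    have "[z - x + x = i * u + (b + k * u)] (mod p)" by (rule cong_add[OF x(3) k(3)])
    then have "[z = b + (i + k) * u] (mod p)" by (simp add: algebra_simps)
    moreover have "i + k \<in> {0..<j + c}" using x k by auto
    ultimately show "z \<in> residues_of ((\<lambda>i. b + i * u) ` {0..<j + c})" unfolding residues_of_def by blast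
  qed
  then have "sz (?T \<uplus> X) \<le> sz (residues_of ((\<lambda>i. b + i * u) ` {0..<j + c}))" by (rule sz_mono)
  also have "\<dots> \<le> int (card ((\<lambda>i. b + i * u) ` {0..<j + c}))" by (rule sz_residues_of_le) simp
  also have "\<dots> \<le> int (card {0..<j + c})" using card_image_le by (meson finite_atLeastLessThan_int of_nat_le_iff)
  finally have "sz (?T \<uplus> X) \<le> j + c" using j c0 by simp
  then show thesis using T that[of ?T] by simp
qed

section \<open>Sets of small sumset\<close>

lemma residues_sumset:
  assumes "periodic A"
  shows "residues_of M \<uplus> A = (\<Union>x\<in>M. shift x A)"
proof (intro equalityI subsetI)
  fix z assume "z \<in> residues_of M \<uplus> A"
  then obtain y x where x: "y \<in> A" "x \<in> M" "[z - y = x] (mod p)" by (auto simp: mem_sumset residues_of_def)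
  have "[z - (z - y) = z - x] (mod p)" by (intro cong_diff x cong_refl)
  then have "z - x \<in> A" using x(1) periodic_cong[OF assms] by simp
  then show "z \<in> (\<Union>x\<in>M. shift x A)" using x by auto
next
  fix z assume "z \<in> (\<Union>x\<in>M. shift x A)"
  then obtain x where x: "x \<in> M" "z - x \<in> A" by auto
  have "[z - (z - x) = x] (mod p)" by simp
  then show "z \<in> residues_of M \<uplus> A" using x unfolding mem_sumset residues_of_def by blast
qed

lemma sz_Int_shifts: "periodic A \<Longrightarrow> sz (shift x A \<inter> shift y A) = sz (A \<inter> shift (x - y) A)"
proof -
  assume "periodic A"
  moreover have "shift x A \<inter> shift y A = shift y (A \<inter> shift (x - y) A)" by auto
  ultimately show ?thesis by simp
qed

lemma sz_Un_shifts: "periodic A \<Longrightarrow> sz (shift x A \<union> shift y A) = 2 * sz A - sz (A \<inter> shift (x - y) A)"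
  using sz_Un_Int[of "shift x A" "shift y A"] sz_Int_shifts[of A x y] by simp

lemma sz_sumset_gt:
  assumes "periodic X" "periodic S" "2 \<le> sz S" "0 < sz X" "sz X < p"
  obtains g where "\<not> p dvd g" "2 * sz X - sz (X \<inter> shift g X) \<le> sz (S \<uplus> X)" "sz X + 1 \<le> sz (S \<uplus> X)"
proof -
  obtain M where M: "M \<subseteq> S" "card M = 2" "finite M"
    "\<And>x y. x \<in> M \<Longrightarrow> y \<in> M \<Longrightarrow> x \<noteq> y \<Longrightarrow> \<not> p dvd x - y"
    using obtain_reps[of S 2] assms(2,3) by auto
  then obtain x y where xy: "M = {x, y}" "x \<noteq> y" by (auto simp: card_2_iff)
  have "shift x X \<union> shift y X \<subseteq> X \<uplus> S" using M(1) xy by (auto intro: subsetD[OF shift_subset_sumset])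
  then have "2 * sz X - sz (X \<inter> shift (x - y) X) \<le> sz (S \<uplus> X)"
    using sz_mono sz_Un_shifts[OF assms(1)] sumset_commute by metis
  moreover have "\<not> p dvd x - y" using M xy by simp
  moreover have "sz (X \<inter> shift (x - y) X) < sz X" using assms calculation by (intro sz_Int_shift_less)
  ultimately show thesis using that by force
qed

lemma sz_residues_pair:
  assumes "\<not> p dvd x - y"
  shows "sz (residues_of {x, y}) = 2"
proof -
  have *: "\<not> p dvd y - x" "x \<noteq> y" using assms by (auto simp: dvd_diff_commute)
  have "sz (residues_of {x, y}) = int (card {x, y})"
    by (rule sz_residues_of) (use assms * in auto)
  then show ?thesis using * by simp
qed

lemma sz_le_1D:
  assumes "periodic S" "sz S \<le> 1" "x \<in> S" "y \<in> S"
  shows "p dvd x - y"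
proof (rule ccontr)
  assume *: "\<not> p dvd x - y"
  then have "sz (residues_of {x, y}) = 2" by (rule sz_residues_pair)
  moreover have "residues_of {x, y} \<subseteq> S" using assms by (intro residues_of_subset) auto
  ultimately show False using sz_mono[of "residues_of {x, y}" S] assms(2) by simp
qed

lemma sz_sumset_translates:
  assumes "periodic A" "periodic X" "int m \<le> sz X"
    and "\<And>g. \<not> p dvd g \<Longrightarrow> sz (A \<inter> shift g A) \<le> b"
  shows "4 * int m * sz A - b * int m * (int m - 1) \<le> 6 * sz (A \<uplus> X)"
proof -
  obtain M where M: "M \<subseteq> X" "card M = m" "finite M"
    "\<And>x y. x \<in> M \<Longrightarrow> y \<in> M \<Longrightarrow> x \<noteq> y \<Longrightarrow> \<not> p dvd x - y"
    using obtain_reps[OF assms(2,3)] by metis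
  show ?thesis
  proof (rule union_of_translates[OF assms(1) _ M(3,2)])
    show "shift x A \<subseteq> A \<uplus> X" if "x \<in> M" for x using that M(1) shift_subset_sumset by blast
    show "sz (A \<inter> shift (x - y) A) \<le> b" if "x \<in> M" "y \<in> M" "x \<noteq> y" for x y
      using M(4)[OF that] assms(4) by blast
  qed
qed

text \<open>To be applied to a \<open>4\<close>-atom \<open>A\<close>. A \<open>2\<close>-atom
  \<open>N\<close> of \<open>A\<close> has growth at most \<open>sz A + 1\<close>, since
  \<open>X\<close> competes with it; its translates share at most one residue, those of
  \<open>A\<close> at most three. Counting \<open>N + A\<close> by translates of either set rules
  out \<open>sz N \<ge> 4\<close>.\<close>

lemma sumset_small_dichotomy:
  assumes per: "periodic A" "periodic X" and A: "5 \<le> sz A" and X: "4 \<le> sz X"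
    and AX: "sz (X \<uplus> A) \<le> p - 4" "sz (X \<uplus> A) \<le> sz A + sz X + 1"
    and Int: "\<And>g. \<not> p dvd g \<Longrightarrow> sz (A \<inter> shift g A) \<le> 3"
  shows "sz A \<le> 6 \<and> (\<exists>d. \<not> p dvd d \<and> 3 \<le> sz (A \<inter> shift d A)) \<or>
    sz A = 5 \<and> iso_ge 2 A 6 \<and> (\<exists>d. \<not> p dvd d \<and> 2 \<le> sz (A \<inter> shift d A))"
proof -
  have A0: "A \<noteq> {}" using A by auto
  have "feasible 2 A X" using per X AX by (simp add: feasible_def)
  then obtain N c where N: "atom 2 A N c" "c \<le> sz A + 1"
    using ex_atom[of 2 A X "sz A + 1"] A0 AX(2) by force
  note N' = atomD[OF N(1)]
  have Int1: "sz (N \<inter> shift g N) \<le> 1" if "\<not> p dvd g" for g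
    using atom_Int_shift[OF N(1) per(1) A0 _ that] by simp
  define a n v where "a = sz A" and "n = sz N" and "v = sz (N \<uplus> A)"
  have v: "v = n + c" "v \<le> n + a + 1" using N'(5) N(2) by (auto simp: a_def n_def v_def)
  have sub: "shift x A \<subseteq> N \<uplus> A" if "x \<in> N" for x
    using shift_subset_sumset[OF that, of A] sumset_commute by metis
  have fromA: "4 * int m * n - int m * (int m - 1) \<le> 6 * v" if m: "int m \<le> a" for m
    using sz_sumset_translates[OF N'(2) per(1) _ Int1] m by (simp add: a_def n_def v_def)
  have fromN: "4 * int m * a - b * int m * (int m - 1) \<le> 6 * v"
    if m: "int m \<le> n" and b: "\<And>g. \<not> p dvd g \<Longrightarrow> sz (A \<inter> shift g A) \<le> b" for m b
    using sz_sumset_translates[OF per(1) N'(2) _ b] m sumset_commute[of A N] by (simp add: a_def n_def v_def)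
  have pair: "2 * a - sz (A \<inter> shift (x - y) A) = sz (residues_of {x, y} \<uplus> A)" for x y
    using residues_sumset[OF per(1), of "{x, y}"] sz_Un_shifts[OF per(1)] by (simp add: a_def)
  \<comment> \<open>If \<open>sz N > 2\<close>, a pair of residues is smaller than the atom
    \<open>N\<close> and so grows by at least \<open>c + 1\<close>.\<close>
  have strict: "v - n + 3 \<le> 2 * a - sz (A \<inter> shift g A)" if "\<not> p dvd g" "2 < n" for g
  proof -
    have "sz (residues_of {g, 0}) + c + 1 \<le> sz (residues_of {g, 0} \<uplus> A)"
      using that sz_residues_pair[of g 0] by (intro atom_strict[OF N(1)]) (auto simp: n_def)
    then show ?thesis using sz_residues_pair[of g 0] pair[of g 0] that v by simp
  qed
  have "2 \<le> n" using N'(3) by (simp add: n_def)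
  then consider "n = 2" | "n = 3" | "n = 4" | "5 \<le> n" by linarith
  then show ?thesis
  proof cases
    case 1
    obtain M where M: "M \<subseteq> N" "card M = 2" "finite M"
      "\<And>x y. x \<in> M \<Longrightarrow> y \<in> M \<Longrightarrow> x \<noteq> y \<Longrightarrow> \<not> p dvd x - y"
      using obtain_reps[of N 2] N'(2,3) by auto
    then obtain x y where xy: "M = {x, y}" "x \<noteq> y" by (auto simp: card_2_iff)
    have d: "\<not> p dvd x - y" using M xy by simp
    have "residues_of {x, y} = N"
      using sz_residues_pair[OF d] 1 M(1) xy N'(2) by (intro sz_subset_eq residues_of_subset) (auto simp: n_def)
    then have eq: "2 * a - sz (A \<inter> shift (x - y) A) = v" using pair by (simp add: v_def)
    show ?thesis
    \<comment> \<open>From \<open>v \<le> a + 3\<close> this overlap is at least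
      \<open>a - 3\<close>, and \<open>Int\<close> caps it at \<open>3\<close>; a smaller overlap is
      possible only for \<open>a = 5\<close>, where it is two and \<open>c = 6\<close>.\<close>
    proof (cases "3 \<le> sz (A \<inter> shift (x - y) A)")
      case True
      then show ?thesis using eq Int[OF d] v 1 d by (force simp: a_def)
    next
      case False
      then have "a = 5" "c = 6" "2 \<le> sz (A \<inter> shift (x - y) A)" using eq v 1 A by (auto simp: a_def)
      then show ?thesis using N'(6) d by (auto simp: a_def)
    qed
  next
    case 2
    obtain M where M: "M \<subseteq> N" "card M = 3" "finite M"
      "\<And>x y. x \<in> M \<Longrightarrow> y \<in> M \<Longrightarrow> x \<noteq> y \<Longrightarrow> \<not> p dvd x - y"
      using obtain_reps[of N 3] N'(2) 2 by (auto simp: n_def)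
    then obtain x y z where xyz: "M = {x, y, z}" "x \<noteq> y" "x \<noteq> z" "y \<noteq> z" by (auto simp: card_3_iff)
    have d: "\<not> p dvd x - y" "\<not> p dvd z - x" "\<not> p dvd z - y" using M xyz by auto
    \<comment> \<open>By \<open>strict\<close> two translates already have at least \<open>v\<close>
      elements, so they fill \<open>N + A\<close> and the third is covered by its overlaps with
      them.\<close>
    have "shift x A \<union> shift y A = N \<uplus> A"
      using strict[OF d(1)] 2 sub M xyz per N'(2) sz_Un_shifts[OF per(1), of x y]
      by (intro sz_subset_eq) (auto simp: a_def v_def)
    then have "shift z A \<subseteq> shift x A \<union> shift y A" using sub M xyz by auto
    then have "(shift z A \<inter> shift x A) \<union> (shift z A \<inter> shift y A) = shift z A" by blast
    then have "sz ((shift z A \<inter> shift x A) \<union> (shift z A \<inter> shift y A)) = a" using per by (simp add: a_def)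
    then have "a \<le> sz (A \<inter> shift (z - x) A) + sz (A \<inter> shift (z - y) A)"
      using sz_Un_Int[of "shift z A \<inter> shift x A" "shift z A \<inter> shift y A"]
        sz_nonneg[of "(shift z A \<inter> shift x A) \<inter> (shift z A \<inter> shift y A)"]
        sz_Int_shifts[OF per(1), of z x] sz_Int_shifts[OF per(1), of z y]
      by linarith
    moreover have "sz (A \<inter> shift (z - x) A) \<le> 3" "sz (A \<inter> shift (z - y) A) \<le> 3" using Int d by auto
    ultimately have "a \<le> 6" "3 \<le> sz (A \<inter> shift (z - x) A) \<or> 3 \<le> sz (A \<inter> shift (z - y) A)"
      using A by (auto simp: a_def)
    then show ?thesis using d by (auto simp: a_def)
  next
    case 3
    \<comment> \<open>Three kinds of bounds: overlaps at most \<open>2 a - v + 1\<close> by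
      \<open>strict\<close>, overlaps at most \<open>3\<close>, and translates of \<open>N\<close>.
      With \<open>v \<le> a + 5\<close>, the first and the last exclude \<open>a = 5\<close> and
      \<open>a = 6\<close>, the second all larger \<open>a\<close>.\<close>
    have "6 * v \<ge> 16 * a - 12 * (2 * a - v + 1)"
      using fromN[of 4 "2 * a - v + 1"] strict 3 by fastforce
    moreover have "6 * v \<ge> 16 * a - 36" using fromN[of 4 3] Int 3 by simp
    moreover have "6 * v \<ge> 60" using fromA[of 5] 3 A by (simp add: a_def)
    moreover have "6 * v \<ge> 66" if "6 \<le> a" using fromA[of 6] 3 that by simp
    ultimately have False using v 3 A by (auto simp: a_def)
    then show ?thesis ..
  next
    case 4
    \<comment> \<open>Five translates of \<open>A\<close> and five of \<open>N\<close> give two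
      linear bounds that are incompatible with \<open>v \<le> n + a + 1\<close> for
      \<open>n \<ge> 5\<close>.\<close>
    have "6 * v \<ge> 20 * a - 60" using fromN[of 5 3] Int 4 by simp
    moreover have "6 * v \<ge> 20 * n - 20" using fromA[of 5] A by (simp add: a_def)
    ultimately have False using v 4 A by (simp add: a_def)
    then show ?thesis ..
  qed
qed

section \<open>Atoms of cardinality four and five\<close>

lemma submodular_shift:
  assumes "periodic S"
  shows "sz ((S \<union> shift g S) \<uplus> X) \<le> 2 * sz (S \<uplus> X) - sz ((S \<inter> shift g S) \<uplus> X)"
  using submodular[of S "shift g S" X] assms by (simp add: shift_sumset)

lemma sz_Un_shift: "periodic S \<Longrightarrow> sz (S \<union> shift g S) = 2 * sz S - sz (S \<inter> shift g S)"
  using sz_Un_Int[of S "shift g S"] by simp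

lemma sz_sumset_ge': "periodic X \<Longrightarrow> S \<noteq> {} \<Longrightarrow> sz X \<le> sz (S \<uplus> X)"
  using sz_sumset_ge[of X S] sumset_commute[of S X] by simp

lemma four_atom_sz:
  assumes X: "periodic X" "4 \<le> sz X" "sz X + 43 \<le> p" and A: "atom 4 X A c" and c: "c \<le> sz X + 1"
  shows "sz A = 4"
proof (rule ccontr)
  assume "sz A \<noteq> 4"
  note A' = atomD[OF A]
  have A5: "5 \<le> sz A" using A'(3) \<open>sz A \<noteq> 4\<close> by simp
  have X0: "X \<noteq> {}" using X(2) by auto
  have no4: "5 + c \<le> sz (T \<uplus> X)" if "periodic T" "sz T = 4" for T
    using atom_strict[OF A, of T] that A5 by simp
  have iso3: "iso_ge 3 X c"
  proof (rule ccontr)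
    assume "\<not> iso_ge 3 X c"
    then obtain M d where M: "atom 3 X M d" "sz M = 3" "d < c"
      using iso_ge_pred[of 3 X c] A'(6) X(1) X0 by auto
    note M' = atomD[OF M(1)]
    have Int2: "sz (M \<inter> shift g M) \<le> 2" if "\<not> p dvd g" for g
      using atom_Int_shift[OF M(1) X(1) X0 _ that] by simp
    show False
    proof (cases "\<exists>g. \<not> p dvd g \<and> 2 \<le> sz (M \<inter> shift g M)")
      case True
      \<comment> \<open>With an overlap of two residues, \<open>M \<union> shift g M\<close> has
        four, and its sumset would have at most \<open>4 + c\<close>.\<close>
      then obtain g where g: "\<not> p dvd g" "sz (M \<inter> shift g M) = 2" using Int2 by force
      have "sz X + 1 \<le> sz ((M \<inter> shift g M) \<uplus> X)"
        using sz_sumset_gt[of X "M \<inter> shift g M"] X M'(2) g(2) by auto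
      moreover have "5 + c \<le> sz ((M \<union> shift g M) \<uplus> X)"
        using M'(2) M(2) g(2) by (intro no4) (auto simp: sz_Un_shift)
      ultimately show False using submodular_shift[OF M'(2), of g X] M'(5) M(2,3) c by simp
    next
      case False
      then have Int1: "sz (M \<inter> shift g M) \<le> 1" if "\<not> p dvd g" for g using that by force
      obtain R where R: "R \<subseteq> M" "card R = 3" "finite R"
        "\<And>x y. x \<in> R \<Longrightarrow> y \<in> R \<Longrightarrow> x \<noteq> y \<Longrightarrow> \<not> p dvd x - y"
        using obtain_reps[of M 3] M'(2) M(2) by auto
      then obtain u v w where uvw: "R = {u, v, w}" "u \<noteq> v" "u \<noteq> w" "v \<noteq> w" by (auto simp: card_3_iff)
      have d: "\<not> p dvd v - u" "\<not> p dvd w - u" "\<not> p dvd v - w" "u \<in> M" "v \<in> M" "w \<in> M"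
        using R uvw by auto
      \<comment> \<open>\<open>W v\<close> and \<open>W w\<close> have five residues each and growth
        at most \<open>c\<close>. They meet in \<open>M\<close> and \<open>v + w - u\<close>, that
        is in four residues, and this intersection would be a fragment, against
        \<open>no4\<close>.\<close>
      define W where "W x = M \<union> shift (x - u) M" for x
      have W: "sz (M \<inter> shift (x - u) M) = 1" "sz (W x) = 5" "feasible 4 X (W x)" "sz (W x \<uplus> X) \<le> sz (W x) + c"
        if x: "x \<in> M" "\<not> p dvd x - u" for x
      proof -
        have x': "x \<in> M \<inter> shift (x - u) M" using x d by simp
        then have "0 < sz (M \<inter> shift (x - u) M)" using M'(2) by (intro sz_posI[OF _ x']) simp
        then show s: "sz (M \<inter> shift (x - u) M) = 1" using Int1[OF x(2)] by simp
        then show W5: "sz (W x) = 5" using M'(2) M(2) by (simp add: W_def sz_Un_shift)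
        have "sz X \<le> sz ((M \<inter> shift (x - u) M) \<uplus> X)" using x' X(1) by (intro sz_sumset_ge') auto
        then show le: "sz (W x \<uplus> X) \<le> sz (W x) + c"
          using submodular_shift[OF M'(2), of "x - u" X] M'(5) M(2,3) c W5 by (simp add: W_def)
        then show "feasible 4 X (W x)" using W5 c X M'(2) by (auto simp: feasible_def W_def)
      qed
      have WW: "W v \<inter> W w = M \<union> (shift (v - u) M \<inter> shift (w - u) M)" by (auto simp: W_def)
      have "v + w - u \<in> shift (v - u) M \<inter> shift (w - u) M" using d by simp
      then have "0 < sz (shift (v - u) M \<inter> shift (w - u) M)" by (rule sz_posI[rotated]) (simp add: M'(2))
      moreover have "sz (shift (v - u) M \<inter> shift (w - u) M) \<le> 1"
        using sz_Int_shifts[OF M'(2), of "v - u" "w - u"] Int1[OF d(3)] by simp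
      moreover have "M \<inter> (shift (v - u) M \<inter> shift (w - u) M) = {}"
      proof (rule ccontr)
        assume "M \<inter> (shift (v - u) M \<inter> shift (w - u) M) \<noteq> {}"
        then obtain z where z: "z \<in> M" "z \<in> shift (v - u) M" "z \<in> shift (w - u) M" by blast
        have "p dvd v - z" using d z M'(2) W(1)[of v] by (intro sz_le_1D[of "M \<inter> shift (v - u) M"]) auto
        moreover have "p dvd w - z" using d z M'(2) W(1)[of w] by (intro sz_le_1D[of "M \<inter> shift (w - u) M"]) auto
        ultimately have "p dvd (v - z) - (w - z)" by (rule dvd_diff)
        then show False using d(3) by simp
      qed
      ultimately have WW4: "sz (W v \<inter> W w) = 4"
        using sz_Un_Int[of M "shift (v - u) M \<inter> shift (w - u) M"] M(2) WW by simp
      have "sz ((W v \<inter> W w) \<uplus> X) = sz (W v \<inter> W w) + c"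
        using W(2-4) d c X WW4 by (intro fragment_Int[OF A'(6)]) auto
      then show False using no4[of "W v \<inter> W w"] WW4 M'(2) by (simp add: W_def)
    qed
  qed
  have AX: "X \<uplus> A = A \<uplus> X" by (rule sumset_commute)
  have Int3: "sz (A \<inter> shift g A) \<le> 3" if "\<not> p dvd g" for g
    using atom_Int_shift[OF A X(1) X0 _ that] by simp
  \<comment> \<open>At most three \<open>d\<close>-runs in \<open>A\<close> put \<open>X\<close>
    into a progression of \<open>c + 1\<close> terms, and four terms with the same difference then
    contradict \<open>no4\<close>.\<close>
  have contra: False if k: "2 \<le> k" "k \<le> 3" "iso_ge k X c" and d: "\<not> p dvd d" "k \<le> sz (A \<inter> shift d A)"
    "sz A - sz (A \<inter> shift d A) \<le> 3" "sz A \<le> 7" for k d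
  proof -
    obtain u b where u: "\<not> p dvd u" "\<And>x. x \<in> X \<Longrightarrow> \<exists>i. 0 \<le> i \<and> i \<le> c \<and> [x = b + i * u] (mod p)"
      using fragment_progression[OF X(1) A'(2) X0 k(3,1,2) d(1) _ d(2-4)] A'(5) c X by auto
    obtain T where "periodic T" "sz T = 4" "sz (T \<uplus> X) \<le> 4 + c"
      using progression_growth[OF u X0, of 4] X by auto
    then show False using no4 by force
  qed
  have "sz A \<le> 6 \<and> (\<exists>d. \<not> p dvd d \<and> 3 \<le> sz (A \<inter> shift d A)) \<or>
    sz A = 5 \<and> iso_ge 2 A 6 \<and> (\<exists>d. \<not> p dvd d \<and> 2 \<le> sz (A \<inter> shift d A))"
    using A'(4,5) AX c by (intro sumset_small_dichotomy[OF A'(2) X(1) A5 X(2) _ _ Int3]) auto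
  then show False
  proof (elim disjE conjE exE)
    fix d assume "sz A \<le> 6" "\<not> p dvd d" "3 \<le> sz (A \<inter> shift d A)"
    then show False using contra[of 3 d] iso3 by simp
  next
    fix d assume a: "sz A = 5" "iso_ge 2 A 6" and d: "\<not> p dvd d" "2 \<le> sz (A \<inter> shift d A)"
    \<comment> \<open>Only an overlap of two is guaranteed here, so the chain has to run with
      \<open>k = 2\<close>.\<close>
    have "iso_ge 2 X c"
    proof (rule ccontr)
      assume "\<not> iso_ge 2 X c"
      then obtain N e where N: "atom 2 X N e" "sz N = 2" "e < c"
        using iso_ge_pred[of 2 X c] iso3 X(1) X0 by auto
      note N' = atomD[OF N(1)]
      obtain R where R: "R \<subseteq> N" "card R = 2" "finite R"
        "\<And>x y. x \<in> R \<Longrightarrow> y \<in> R \<Longrightarrow> x \<noteq> y \<Longrightarrow> \<not> p dvd x - y"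
        using obtain_reps[of N 2] N'(2) N(2) by auto
      then obtain u v where uv: "R = {u, v}" "u \<noteq> v" by (auto simp: card_2_iff)
      have uvN: "u \<in> N" "v \<in> N" using R uv by auto
      define g where "g = v - u"
      have g: "\<not> p dvd g" using R uv by (simp add: g_def)
      have "v \<in> N \<inter> shift g N" using uvN by (simp add: g_def)
      then have ne: "N \<inter> shift g N \<noteq> {}" by blast
      then have s1: "sz (N \<inter> shift g N) = 1"
        using atom_Int_shift[OF N(1) X(1) X0 _ g] sz_pos_iff[of "N \<inter> shift g N"] N'(2) by simp
      then have s3: "sz (N \<union> shift g N) = 3" using N'(2) N(2) by (simp add: sz_Un_shift)
      have "sz X \<le> sz ((N \<inter> shift g N) \<uplus> X)" using ne X(1) by (intro sz_sumset_ge') auto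
      then have up: "sz ((N \<union> shift g N) \<uplus> X) \<le> 4 + 2 * e - sz X"
        using submodular_shift[OF N'(2), of g X] N'(5) N(2) by simp
      have "min (sz (N \<union> shift g N) + c) (p - 3 + 1) \<le> sz ((N \<union> shift g N) \<uplus> X)"
        using iso_ge_large[OF iso3, of "N \<union> shift g N"] N'(2) s3 by simp
      \<comment> \<open>The three residues of \<open>N \<union> shift g N\<close> have a sumset
        between \<open>3 + c\<close> and \<open>4 + 2 e - sz X\<close>; with
        \<open>e < c \<le> sz X + 1\<close> only these values remain.\<close>
      then have ce: "c = sz X + 1" "e = sz X" using up s3 N(3) c X by (auto simp: min_def split: if_splits)
      have "sz (residues_of {v, u}) = 2" using g unfolding g_def by (rule sz_residues_pair)
      then have "residues_of {v, u} = N"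
        using uvN N'(2) N(2) by (intro sz_subset_eq residues_of_subset) simp_all
      then have "sz (N \<uplus> X) = 2 * sz X - sz (X \<inter> shift g X)"
        using residues_sumset[OF X(1), of "{v, u}"] sz_Un_shifts[OF X(1), of v u] by (simp add: g_def)
      then have Xg: "sz (X \<inter> shift g X) = sz X - 2" using N'(5) N(2) ce by simp
      have "feasible 2 A X" unfolding feasible_def AX using X(1,2) A'(4) by simp
      then have "feasible 2 A (X \<inter> shift g X)"
        by (rule feasible_subset) (use X(1,2) Xg in simp_all)
      then have "sz X + 4 \<le> sz ((X \<inter> shift g X) \<uplus> A)" using iso_geD[OF a(2)] Xg by fastforce
      \<comment> \<open>One set is estimated twice: from above by submodularity with respect to
        \<open>A\<close>, and from below as \<open>(A \<union> shift g A) + X\<close>, which has at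
        least \<open>sz X + 9\<close> elements.\<close>
      then have upper: "sz ((X \<union> shift g X) \<uplus> A) \<le> sz X + 8"
        using submodular_shift[OF X(1), of g A] A'(5) AX a(1) ce by simp
      have "sz (residues_of {g, 0}) = 2" using sz_residues_pair[of g 0] g by simp
      moreover have pair: "sz (residues_of {g, 0} \<uplus> A) = 10 - sz (A \<inter> shift g A)"
        using residues_sumset[OF A'(2), of "{g, 0}"] sz_Un_shifts[OF A'(2), of g 0] a(1) by simp
      moreover have "sz (residues_of {g, 0} \<uplus> A) \<le> p - 2" using pair X sz_nonneg[of "A \<inter> shift g A"] by linarith
      ultimately have "sz (A \<inter> shift g A) \<le> 2"
        using iso_geD[OF a(2), of "residues_of {g, 0}"] by (simp add: feasible_def)
      then have "8 \<le> sz (A \<union> shift g A)" using A'(2) a(1) by (simp add: sz_Un_shift)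
      then have "min (sz (A \<union> shift g A) + c) (p - 4 + 1) \<le> sz ((A \<union> shift g A) \<uplus> X)"
        using A'(2) by (intro iso_ge_large[OF A'(6)]) auto
      moreover have "(A \<union> shift g A) \<uplus> X = (X \<union> shift g X) \<uplus> A"
        by (simp add: sumset_Un shift_sumset AX)
      ultimately show False using upper \<open>8 \<le> sz (A \<union> shift g A)\<close> ce X by simp
    qed
    then show False using contra[of 2 d] a(1) d by simp
  qed
qed

text \<open>Otherwise two translates of \<open>X\<close> share three residues, so \<open>X\<close>
  is a progression with difference \<open>g\<close>; then \<open>0, g, ..., 4 g\<close> has a sumset
  of at most \<open>8\<close> elements instead of at least \<open>10\<close>.\<close>

lemma progression_iso:
  assumes X: "periodic X" "sz X = 4" "47 \<le> p" and iso: "iso_ge 5 X 5"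
    and S: "periodic S" "2 \<le> sz S"
  shows "6 \<le> sz (S \<uplus> X)"
proof (rule ccontr)
  assume small: "\<not> ?thesis"
  obtain g where g: "\<not> p dvd g" "2 * sz X - sz (X \<inter> shift g X) \<le> sz (S \<uplus> X)"
    using sz_sumset_gt[of X S] X S by auto
  let ?T = "block g 4 (residues_of {0})"
  have "sz (residues_of {0}) = 1" using sz_residues_of[of "{0}"] by simp
  then have T: "5 \<le> sz ?T" using sz_block_ge[of "residues_of {0}" g 4] g X by simp
  have "residues_of {0} \<uplus> X = X" using residues_sumset[OF X(1), of "{0}"] by (auto simp: shift_def)
  then have "sz (?T \<uplus> X) \<le> 8"
    using sz_block_le[OF X(1), of g 4] g small X by (simp add: block_sumset[symmetric])
  moreover have "min (sz ?T + 5) (p - 5 + 1) \<le> sz (?T \<uplus> X)"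
    using T by (intro iso_ge_large[OF iso]) auto
  ultimately show False using T X by simp
qed

text \<open>As \<open>X\<close> has just four residues, counting \<open>A + X\<close> by four
  translates of \<open>A\<close> bounds \<open>A\<close> directly, with no auxiliary atom of
  \<open>A\<close>.\<close>

lemma five_atom_sz:
  assumes X: "periodic X" "sz X = 4" "47 \<le> p" and A: "atom 5 X A c" and c: "c \<le> 5"
  shows "sz A = 5"
proof (rule ccontr)
  assume "sz A \<noteq> 5"
  note A' = atomD[OF A]
  have A6: "6 \<le> sz A" using A'(3) \<open>sz A \<noteq> 5\<close> by simp
  have X0: "X \<noteq> {}" using X(2) by auto
  \<comment> \<open>The unions of translates below have five or six residues. For five the bound is
    sharpened by \<open>atom_strict\<close>, for six it is the plain one.\<close>
  have no5: "6 + c \<le> sz (T \<uplus> X)" if "periodic T" "sz T = 5 \<or> sz T = 6" for T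
  proof (cases "sz T = 5")
    case True
    then show ?thesis using atom_strict[OF A that(1)] A6 by simp
  next
    case False
    then show ?thesis using iso_ge_large[OF A'(6) that(1)] that(2) c X by simp
  qed
  have ap: "6 \<le> sz (S \<uplus> X)" if "c = 5" "periodic S" "2 \<le> sz S" for S
    using progression_iso[OF X _ that(2,3)] A'(6) that(1) by simp
  have ge5: "5 \<le> sz (S \<uplus> X)" if "periodic S" "2 \<le> sz S" for S
    using sz_sumset_gt[OF X(1) that] X by auto
  have iso4: "iso_ge 4 X c"
  proof (rule ccontr)
    assume "\<not> iso_ge 4 X c"
    then obtain T e where T: "atom 4 X T e" "sz T = 4" "e < c"
      using iso_ge_pred[of 4 X c] A'(6) X(1) X0 by auto
    note T' = atomD[OF T(1)]
    \<comment> \<open>With overlaps of at most one, counting would give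
      \<open>52 \<le> 6 sz (T + X)\<close>, but \<open>sz (T + X) \<le> 8\<close>.\<close>
    have "\<exists>g. \<not> p dvd g \<and> 2 \<le> sz (T \<inter> shift g T)"
    proof (rule ccontr)
      assume "\<not> ?thesis"
      then have "sz (T \<inter> shift g T) \<le> 1" if "\<not> p dvd g" for g using that by force
      then have "52 \<le> 6 * sz (T \<uplus> X)"
        using sz_sumset_translates[OF T'(2) X(1), of 4 1] X(2) T(2) by simp
      then show False using T'(5) T(2,3) c by simp
    qed
    then obtain g where g: "\<not> p dvd g" "2 \<le> sz (T \<inter> shift g T)" by blast
    have "sz (T \<inter> shift g T) \<le> 3" using atom_Int_shift[OF T(1) X(1) X0 _ g(1)] by simp
    then have "6 + c \<le> sz ((T \<union> shift g T) \<uplus> X)"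
      using g T'(2) T(2) by (intro no5) (auto simp: sz_Un_shift)
    then have le: "sz ((T \<inter> shift g T) \<uplus> X) \<le> 2 * (4 + e) - 6 - c"
      using submodular_shift[OF T'(2), of g X] T'(5) T(2) by simp
    \<comment> \<open>The bound in \<open>le\<close> is at most \<open>c\<close>, so a sumset of at
      least \<open>5\<close> forces \<open>c = 5\<close>; then \<open>ap\<close> demands
      \<open>6\<close>.\<close>
    then have "c = 5" using ge5[of "T \<inter> shift g T"] T'(2) g T(3) c by simp
    then show False using ap[of "T \<inter> shift g T"] le T'(2) g T(3) c by simp
  qed
  have iso3: "iso_ge 3 X c"
  proof (rule ccontr)
    assume "\<not> iso_ge 3 X c"
    then obtain M d where M: "atom 3 X M d" "sz M = 3" "d < c"
      using iso_ge_pred[of 3 X c] iso4 X(1) X0 by auto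
    note M' = atomD[OF M(1)]
    show False
    proof (cases "\<exists>g. \<not> p dvd g \<and> 2 \<le> sz (M \<inter> shift g M)")
      case True
      then obtain g where g: "\<not> p dvd g" "2 \<le> sz (M \<inter> shift g M)" by blast
      then have "sz (M \<inter> shift g M) = 2" using atom_Int_shift[OF M(1) X(1) X0 _ g(1)] by simp
      then have s4: "sz (M \<union> shift g M) = 4" using M'(2) M(2) by (simp add: sz_Un_shift)
      have "4 + c \<le> sz ((M \<union> shift g M) \<uplus> X)"
        using iso_ge_large[OF iso4, of "M \<union> shift g M"] M'(2) s4 c X by simp
      then have le: "sz ((M \<inter> shift g M) \<uplus> X) \<le> 2 * (3 + d) - 4 - c"
        using submodular_shift[OF M'(2), of g X] M'(5) M(2) by simp
      then have "c = 5" using ge5[of "M \<inter> shift g M"] M'(2) g M(3) c by simp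
      then show False using ap[of "M \<inter> shift g M"] le M'(2) g M(3) c by simp
    next
      case False
      obtain R where R: "R \<subseteq> M" "card R = 2" "finite R"
        "\<And>x y. x \<in> R \<Longrightarrow> y \<in> R \<Longrightarrow> x \<noteq> y \<Longrightarrow> \<not> p dvd x - y"
        using obtain_reps[of M 2] M'(2) M(2) by auto
      then obtain u v where uv: "R = {u, v}" "u \<noteq> v" by (auto simp: card_2_iff)
      define g where "g = v - u"
      have g: "\<not> p dvd g" using R uv by (simp add: g_def)
      have "v \<in> M \<inter> shift g M" using R uv by (simp add: g_def)
      then have ne: "M \<inter> shift g M \<noteq> {}" by blast
      then have s1: "sz (M \<inter> shift g M) = 1"
        using False g sz_pos_iff[of "M \<inter> shift g M"] M'(2) by force
      have "6 + c \<le> sz ((M \<union> shift g M) \<uplus> X)"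
        using s1 M'(2) M(2) by (intro no5) (auto simp: sz_Un_shift)
      moreover have "sz X \<le> sz ((M \<inter> shift g M) \<uplus> X)" using ne X(1) by (intro sz_sumset_ge') auto
      ultimately show False using submodular_shift[OF M'(2), of g X] M'(5) M(2,3) X(2) c by simp
    qed
  qed
  have count: "16 * sz A - 12 * b \<le> 6 * (sz A + c)"
    if "\<And>g. \<not> p dvd g \<Longrightarrow> sz (A \<inter> shift g A) \<le> b" for b
    using sz_sumset_translates[OF A'(2) X(1), of 4 b] X(2) that A'(5) by simp
  have "sz (A \<inter> shift g A) \<le> 4" if "\<not> p dvd g" for g
    using atom_Int_shift[OF A X(1) X0 _ that] by simp
  then have a7: "sz A \<le> 7" using count[of 4] c by simp
  \<comment> \<open>If all overlaps were at most \<open>sz A - 4\<close>, then \<open>count\<close>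
    would give \<open>sz A \<ge> 9\<close>. Hence some difference leaves at most three runs.\<close>
  have "\<exists>g. \<not> p dvd g \<and> sz A - 3 \<le> sz (A \<inter> shift g A)"
  proof (rule ccontr)
    assume "\<not> ?thesis"
    then have "sz (A \<inter> shift g A) \<le> sz A - 4" if "\<not> p dvd g" for g using that by force
    then show False using count[of "sz A - 4"] c a7 by simp
  qed
  then obtain d where d: "\<not> p dvd d" "sz A - 3 \<le> sz (A \<inter> shift d A)" by blast
  obtain u b where u: "\<not> p dvd u" "\<And>x. x \<in> X \<Longrightarrow> \<exists>i. 0 \<le> i \<and> i \<le> c \<and> [x = b + i * u] (mod p)"
    using fragment_progression[OF X(1) A'(2) X0 iso3 _ _ d(1)] A'(5) c X d A6 a7 by auto
  obtain T where "periodic T" "sz T = 5" "sz (T \<uplus> X) \<le> 5 + c"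
    using progression_growth[OF u X0, of 5] X by auto
  then show False using no5 by force
qed

section \<open>Transfer to \<open>residue_ring\<close>\<close>

definition lift :: "int set \<Rightarrow> int set" where
  "lift S = {z. z mod p \<in> S}"

lemma periodic_lift [simp]: "periodic (lift S)"
  by (simp add: periodic_def lift_def)

lemma carrier_residue_ring: "carrier (residue_ring p) = {0..<p}"
  by (auto simp: residue_ring_def)

lemma sz_lift: "S \<subseteq> {0..<p} \<Longrightarrow> sz (lift S) = int (card S)"
  unfolding sz_def lift_def by (rule arg_cong[where f = "\<lambda>S. int (card S)"]) auto

lemma lift_window:
  assumes "periodic S"
  shows "lift (S \<inter> {0..<p}) = S"
  using periodic_mod[OF assms] p_gt_1 by (auto simp: lift_def)

lemma set_add_residue_ring: "S <+>\<^bsub>residue_ring p\<^esub> X = {(s + x) mod p |s x. s \<in> S \<and> x \<in> X}"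
  unfolding set_add_def set_mult_def residue_ring_def by auto

lemma lift_set_add:
  assumes "S \<subseteq> {0..<p}" "X \<subseteq> {0..<p}"
  shows "lift (S <+>\<^bsub>residue_ring p\<^esub> X) = lift S \<uplus> lift X"
proof (intro equalityI subsetI)
  fix z assume "z \<in> lift (S <+>\<^bsub>residue_ring p\<^esub> X)"
  then obtain s x where sx: "s \<in> S" "x \<in> X" "z mod p = (s + x) mod p"
    by (auto simp: lift_def set_add_residue_ring)
  have "(z - x) mod p = (s + x - x) mod p" using sx(3) by (metis mod_diff_left_eq)
  moreover have "s mod p = s" "x mod p = x" using sx assms by auto
  ultimately have "(z - x) mod p \<in> S" "x mod p \<in> X" using sx by simp_all
  then show "z \<in> lift S \<uplus> lift X" unfolding mem_sumset lift_def by blast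
next
  fix z assume "z \<in> lift S \<uplus> lift X"
  then obtain x where x: "x mod p \<in> X" "(z - x) mod p \<in> S" by (auto simp: mem_sumset lift_def)
  have "z mod p = ((z - x) mod p + x mod p) mod p" by (simp add: mod_simps)
  then show "z \<in> lift (S <+>\<^bsub>residue_ring p\<^esub> X)" using x by (auto simp: lift_def set_add_residue_ring)
qed

lemma sz_lift_sumset:
  assumes "S \<subseteq> {0..<p}" "X \<subseteq> {0..<p}"
  shows "sz (lift S \<uplus> lift X) = int (card (S <+>\<^bsub>residue_ring p\<^esub> X))"
proof -
  have "S <+>\<^bsub>residue_ring p\<^esub> X \<subseteq> {0..<p}" using p_gt_1 by (auto simp: set_add_residue_ring)
  then show ?thesis using sz_lift lift_set_add[OF assms] by metis
qed

end

text \<open>Admissible sets lie in the finite carrier, so the minimum is over a finite nonempty set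
  and is attained.\<close>

lemma isoperimetric_number_le:
  assumes "admissible p k X S"
  shows "isoperimetric_number p k X \<le> growth p X S"
    and "\<exists>S. admissible p k X S \<and> isoperimetric_number p k X = growth p X S"
proof -
  let ?G = "{growth p X S |S. admissible p k X S}"
  have "?G \<subseteq> growth p X ` Pow (carrier (residue_ring (int p)))" by (auto simp: admissible_def)
  moreover have "finite (carrier (residue_ring (int p)))" by (simp add: residue_ring_def)
  ultimately have fin: "finite ?G" by (meson finite_Pow_iff finite_imageI finite_subset)
  have iso: "isoperimetric_number p k X = Min ?G" using assms by (auto simp: isoperimetric_number_def)
  show "isoperimetric_number p k X \<le> growth p X S" unfolding iso using fin assms by (intro Min_le) auto
  have "Min ?G \<in> ?G" using fin assms by (intro Min_in) auto
  then show "\<exists>S. admissible p k X S \<and> isoperimetric_number p k X = growth p X S" unfolding iso by auto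
qed

text \<open>Lifting and intersecting with \<open>{0..<p}\<close> are mutually inverse, so every
  feasible periodic set comes from an admissible one and minimality carries over.\<close>

lemma is_atom_lift:
  assumes "prime p" "X \<subseteq> carrier (residue_ring (int p))" "is_atom p k X A"
  shows "prime_modulus.atom (int p) (int k) (prime_modulus.lift (int p) X) (prime_modulus.lift (int p) A)
      (isoperimetric_number p k X)"
    and "prime_modulus.sz (int p) (prime_modulus.lift (int p) A) = int (card A)"
proof -
  interpret prime_modulus "int p" using assms(1) by unfold_locales simp
  have X: "X \<subseteq> {0..<int p}" using assms(2) by (simp add: carrier_residue_ring)
  have adm: "admissible p k X S \<longleftrightarrow> feasible k (lift X) (lift S)"
    "growth p X S = sz (lift S \<uplus> lift X) - sz (lift S)" if "S \<subseteq> {0..<int p}" for S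
    using that X by (auto simp: admissible_def growth_def feasible_def carrier_residue_ring sz_lift sz_lift_sumset)
  have frag: "is_fragment p k X A" and min: "\<And>S. is_fragment p k X S \<Longrightarrow> card A \<le> card S"
    using assms(3) by (auto simp: is_atom_def is_arg_min_linorder)
  have A: "A \<subseteq> {0..<int p}"
    using frag by (auto simp: is_fragment_def admissible_def carrier_residue_ring)
  then show "sz (lift A) = int (card A)" by (rule sz_lift)
  have w: "S \<inter> {0..<int p} \<subseteq> {0..<int p}" for S by blast
  have "admissible p k X A" using frag by (simp add: is_fragment_def)
  note iso = isoperimetric_number_le(1)
  show "atom k (lift X) (lift A) (isoperimetric_number p k X)"
    unfolding atom_def iso_ge_def
  proof (intro conjI allI impI)
    show "feasible k (lift X) (lift A)" using \<open>admissible p k X A\<close> adm(1)[OF A] by simp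
    show "sz (lift A \<uplus> lift X) = sz (lift A) + isoperimetric_number p k X"
      using frag adm(2)[OF A] by (simp add: is_fragment_def)
    fix S assume S: "feasible k (lift X) S"
    then have lw: "lift (S \<inter> {0..<int p}) = S" by (simp add: lift_window feasible_def)
    have aS: "admissible p k X (S \<inter> {0..<int p})" using adm(1)[OF w] S lw by simp
    then show "sz S + isoperimetric_number p k X \<le> sz (S \<uplus> lift X)"
      using iso[OF aS] adm(2)[OF w, of S] lw by simp
    assume "sz (S \<uplus> lift X) = sz S + isoperimetric_number p k X"
    then have "is_fragment p k X (S \<inter> {0..<int p})"
      using aS adm(2)[OF w, of S] lw by (simp add: is_fragment_def)
    then have "card A \<le> card (S \<inter> {0..<int p})" by (rule min)
    then show "sz (lift A) \<le> sz S" using sz_lift[OF A] by (simp add: sz_def)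
  qed
qed

theorem theorem4p1:
  fixes p :: nat and X :: "int set"
  assumes "prime p"
    and "X \<subseteq> carrier (residue_ring (int p))"
    and "\<zero>\<^bsub>residue_ring (int p)\<^esub> \<in> X"
    and "card X \<ge> 4"
    and "isoperimetric_number p 5 X \<le> int (card X) + 1"
    and "p > card X + 42"
  shows "(\<forall>A. is_atom p 4 X A \<longrightarrow> card A = 4) \<and>
         (card X = 4 \<longrightarrow> (\<forall>A. is_atom p 5 X A \<longrightarrow> card A = 5))"
proof -
  interpret prime_modulus "int p" using assms(1) by unfold_locales simp
  have X: "X \<subseteq> {0..<int p}" using assms(2) by (simp add: carrier_residue_ring)
  have szX: "sz (lift X) = int (card X)" by (rule sz_lift[OF X])
  \<comment> \<open>Without admissible sets the value would be \<open>p\<close> by convention, which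
    exceeds \<open>card X + 1\<close>.\<close>
  have "\<exists>S. admissible p 5 X S" using assms(5,6) by (auto simp: isoperimetric_number_def split: if_splits)
  then obtain S where S: "admissible p 5 X S" "isoperimetric_number p 5 X = growth p X S"
    using isoperimetric_number_le(2) by blast
  \<comment> \<open>Sets admissible for \<open>5\<close> are admissible for \<open>4\<close>, so the
    bound passes to the smaller index.\<close>
  then have "admissible p 4 X S" by (auto simp: admissible_def)
  then have iso4: "isoperimetric_number p 4 X \<le> int (card X) + 1"
    using isoperimetric_number_le(1) S(2) assms(5) by fastforce
  show ?thesis
  proof (intro conjI allI impI)
    fix A assume A: "is_atom p 4 X A"
    show "card A = 4"
      using four_atom_sz[of "lift X" "lift A"] is_atom_lift[OF assms(1,2) A] iso4 szX assms(4,6) by auto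
  next
    fix A assume "card X = 4" and A: "is_atom p 5 X A"
    then show "card A = 5"
      using five_atom_sz[of "lift X" "lift A"] is_atom_lift[OF assms(1,2) A] szX assms(5,6) by auto
  qed
qed

end
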